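(* Let $E$ be a real or complex Banach lattice with order continuous norm and let $u \in E_+$. If $T_1, T_2 \in \mathcal{L}(E)$ satisfy $T_k E \subseteq E_u$ for $k \in \{1,2\}$, then $T_2T_1 \in \mathcal{L}(E)$ is compact.
   Context: $E_+$ denotes the positive cone of the Banach lattice $E$ and $\mathcal{L}(E)$ the space of bounded linear operators on $E$. For $u \in E_+$ the principal ideal generated by $u$ is $E_u := \{f \in E : \exists c \ge 0,\ |f| \le cu\}$. A real Banach lattice has order continuous norm if every downward directed net in it with infimum $0$ converges to $0$ in norm; a complex Banach lattice $E$ has order continuous norm if its real part $E_{\mathbb{R}}$ has order continuous norm. *)

theory Defs
  imports "HOL-Analysis.Analysis" "HOL-Library.Lattice_Algebras" "HOL-Library.Lub_Glb"
begin

section \<open>Real Banach lattices\<close>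

class banach_lattice = banach + ordered_real_vector + lattice_ab_group_add_abs +
  assumes norm_mono_abs: "\<bar>x\<bar> \<le> \<bar>y\<bar> \<Longrightarrow> norm x \<le> norm y"

instance real :: banach_lattice
  by standard simp

lemma norm_abs_lattice: "norm \<bar>x\<bar> = norm (x :: 'a::banach_lattice)"
  by (intro antisym norm_mono_abs) simp_all

lemma norm_mono_nonneg:
  fixes x y :: "'a::banach_lattice"
  assumes "0 \<le> x" "x \<le> y"
  shows "norm x \<le> norm y"
  using assms by (intro norm_mono_abs) (simp add: order_trans[OF assms])

lemma scaleR_le_abs_scaleR_abs:
  fixes x :: "'a::banach_lattice"
  shows "c *\<^sub>R x \<le> \<bar>c\<bar> *\<^sub>R \<bar>x\<bar>"
proof (cases "0 \<le> c")
  case True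
  then show ?thesis by (simp add: scaleR_left_mono abs_ge_self)
next
  case False
  then have "(- c) *\<^sub>R (- x) \<le> (- c) *\<^sub>R \<bar>x\<bar>"
    by (intro scaleR_left_mono abs_ge_minus_self) simp
  with False show ?thesis by simp
qed

lemma LIMSEQ_nonneg_lattice:
  fixes f :: "nat \<Rightarrow> 'a::banach_lattice"
  assumes lim: "f \<longlonglongrightarrow> l" and ge: "\<And>n. 0 \<le> f n"
  shows "0 \<le> l"
proof -
  have "norm (sup (- l) 0) \<le> norm (f n - l)" for n
  proof -
    have "- l \<le> f n - l" using ge[of n] by simp
    also have "\<dots> \<le> \<bar>f n - l\<bar>" by (rule abs_ge_self)
    finally have "sup (- l) 0 \<le> \<bar>f n - l\<bar>" by simp
    then have "norm (sup (- l) 0) \<le> norm \<bar>f n - l\<bar>"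
      by (intro norm_mono_nonneg) simp_all
    then show ?thesis by (simp add: norm_abs_lattice)
  qed
  moreover have "(\<lambda>n. norm (f n - l)) \<longlonglongrightarrow> 0"
    using lim by (simp add: LIM_zero tendsto_norm_zero)
  ultimately have "norm (sup (- l) 0) \<le> 0"
    by (intro LIMSEQ_le_const) auto
  then have "sup (- l) 0 = 0" by simp
  then have "- l \<le> 0" by (metis sup_ge1)
  then show ?thesis by simp
qed

lemma LIMSEQ_mono_lattice:
  fixes f g :: "nat \<Rightarrow> 'a::banach_lattice"
  assumes "f \<longlonglongrightarrow> a" "g \<longlonglongrightarrow> b" "\<And>n. f n \<le> g n"
  shows "a \<le> b"
  using LIMSEQ_nonneg_lattice[OF tendsto_diff[OF assms(2,1)]] assms(3) by simp

section \<open>Order continuous norm\<close>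

text \<open>\<open>r i j\<close> reads: \<open>j\<close> comes after (or equals) \<open>i\<close>.\<close>

definition directed_index :: "'i set \<Rightarrow> ('i \<Rightarrow> 'i \<Rightarrow> bool) \<Rightarrow> bool" where
  "directed_index I r \<longleftrightarrow> I \<noteq> {} \<and> (\<forall>i\<in>I. r i i) \<and>
     (\<forall>i\<in>I. \<forall>j\<in>I. \<forall>k\<in>I. r i j \<longrightarrow> r j k \<longrightarrow> r i k) \<and>
     (\<forall>i\<in>I. \<forall>j\<in>I. \<exists>k\<in>I. r i k \<and> r j k)"

definition downward_directed_net ::
    "'i set \<Rightarrow> ('i \<Rightarrow> 'i \<Rightarrow> bool) \<Rightarrow> ('i \<Rightarrow> 'a::order) \<Rightarrow> bool" where
  "downward_directed_net I r x \<longleftrightarrow>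
     directed_index I r \<and> (\<forall>i\<in>I. \<forall>j\<in>I. r i j \<longrightarrow> x j \<le> x i)"

definition net_tendsto ::
    "'i set \<Rightarrow> ('i \<Rightarrow> 'i \<Rightarrow> bool) \<Rightarrow> ('i \<Rightarrow> 'a::metric_space) \<Rightarrow> 'a \<Rightarrow> bool" where
  "net_tendsto I r x l \<longleftrightarrow> (\<forall>e>0. \<exists>i\<in>I. \<forall>j\<in>I. r i j \<longrightarrow> dist (x j) l < e)"

text \<open>The index sets range over subsets of \<open>E\<close> itself, since a definition cannot quantify over
  types. Nothing is lost: by \<open>order_continuous_normD\<close> below the property carries over to nets
  indexed by a directed set of any type.\<close>

definition order_continuous_norm :: "'a::banach_lattice itself \<Rightarrow> bool" where
  "order_continuous_norm _ \<longleftrightarrow>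
     (\<forall>(I::'a set) r (x::'a \<Rightarrow> 'a). downward_directed_net I r x \<longrightarrow> isGlb UNIV (x ` I) 0
        \<longrightarrow> net_tendsto I r x 0)"

lemma order_continuous_normD:
  fixes I :: "'i set" and x :: "'i \<Rightarrow> 'a::banach_lattice"
  assumes oc: "order_continuous_norm TYPE('a)"
    and net: "downward_directed_net I r x" and glb: "isGlb UNIV (x ` I) 0"
  shows "net_tendsto I r x 0"
  unfolding net_tendsto_def
proof (intro allI impI)
  fix e :: real assume "e > 0"
  let ?D = "x ` I"
  have dir: "\<exists>k\<in>I. x k \<le> x i \<and> x k \<le> x j" if "i \<in> I" "j \<in> I" for i j
    using net that unfolding downward_directed_net_def directed_index_def by meson
  have "downward_directed_net ?D (\<lambda>a b. b \<le> a) (\<lambda>a. a)"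
    unfolding downward_directed_net_def directed_index_def
  proof (intro conjI ballI impI)
    show "?D \<noteq> {}"
      using net unfolding downward_directed_net_def directed_index_def by blast
    show "\<exists>c\<in>?D. c \<le> a \<and> c \<le> b" if "a \<in> ?D" "b \<in> ?D" for a b
      using dir that by blast
  qed auto
  then have "net_tendsto ?D (\<lambda>a b. b \<le> a) (\<lambda>a. a) 0"
    using oc glb unfolding order_continuous_norm_def by simp
  then obtain i where i: "i \<in> I" "norm (x i) < e"
    using \<open>e > 0\<close> unfolding net_tendsto_def by fastforce
  have "dist (x j) 0 < e" if "j \<in> I" "r i j" for j
  proof -
    have "0 \<le> x j"
      using glb that(1) unfolding isGlb_def greatestP_def isLb_def setge_def by auto
    moreover have "x j \<le> x i"
      using net i(1) that unfolding downward_directed_net_def by blast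
    ultimately have "norm (x j) \<le> norm (x i)" by (rule norm_mono_nonneg)
    with i(2) show ?thesis by simp
  qed
  with i(1) show "\<exists>i\<in>I. \<forall>j\<in>I. r i j \<longrightarrow> dist (x j) 0 < e" by blast
qed

section \<open>Complex Banach lattices\<close>

text \<open>A complex Banach lattice is the complexification \<open>E = E\<^sub>\<real> + i E\<^sub>\<real>\<close> of a real Banach lattice,
  with modulus \<open>|x + i y| = sup\<^sub>\<theta> (cos \<theta> x + sin \<theta> y)\<close> and norm \<open>\<parallel>z\<parallel> = \<parallel>|z|\<parallel>\<close>.\<close>

datatype 'a complexification = Complexification (real_part: 'a) (imag_part: 'a)

definition modulus :: "'a::banach_lattice complexification \<Rightarrow> 'a" where
  "modulus z = (THE s. isLub UNIV
     (range (\<lambda>\<theta>. cos \<theta> *\<^sub>R real_part z + sin \<theta> *\<^sub>R imag_part z)) s)"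

lemma isLub_UNIV_iff:
  "isLub UNIV A s \<longleftrightarrow> (\<forall>a\<in>A. a \<le> s) \<and> (\<forall>b. (\<forall>a\<in>A. a \<le> b) \<longrightarrow> s \<le> b)"
  unfolding isLub_def leastP_def isUb_def setle_def setge_def by auto

lemma abs_cos_diff_le: "\<bar>cos s - cos t\<bar> \<le> \<bar>s - t\<bar>" for s t :: real
proof -
  have "\<bar>cos s - cos t\<bar> = 2 * (\<bar>sin ((s + t) / 2)\<bar> * \<bar>sin ((t - s) / 2)\<bar>)"
    by (simp add: cos_diff_cos abs_mult)
  also have "\<dots> \<le> 2 * (1 * \<bar>(t - s) / 2\<bar>)"
    by (intro mult_left_mono mult_mono abs_sin_le_one abs_sin_x_le_abs_x) auto
  finally show ?thesis by simp
qed

lemma abs_sin_diff_le: "\<bar>sin s - sin t\<bar> \<le> \<bar>s - t\<bar>" for s t :: real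
  using abs_cos_diff_le[of "pi/2 - s" "pi/2 - t"] by (simp add: cos_diff)

lemma modulus_exists:
  fixes x y :: "'a::banach_lattice"
  shows "\<exists>s. isLub UNIV (range (\<lambda>\<theta>. cos \<theta> *\<^sub>R x + sin \<theta> *\<^sub>R y)) s"
proof -
  define f where "f \<theta> = cos \<theta> *\<^sub>R x + sin \<theta> *\<^sub>R y" for \<theta> :: real
  define a where "a = \<bar>x\<bar> + \<bar>y\<bar>"
  have a0: "0 \<le> a" by (simp add: a_def)
  have lip: "f s \<le> f t + \<bar>s - t\<bar> *\<^sub>R a" for s t
  proof -
    have "f s - f t = (cos s - cos t) *\<^sub>R x + (sin s - sin t) *\<^sub>R y"
      by (simp add: f_def algebra_simps)
    also have "\<dots> \<le> \<bar>cos s - cos t\<bar> *\<^sub>R \<bar>x\<bar> + \<bar>sin s - sin t\<bar> *\<^sub>R \<bar>y\<bar>"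
      by (intro add_mono scaleR_le_abs_scaleR_abs)
    also have "\<dots> \<le> \<bar>s - t\<bar> *\<^sub>R \<bar>x\<bar> + \<bar>s - t\<bar> *\<^sub>R \<bar>y\<bar>"
      by (intro add_mono scaleR_right_mono abs_cos_diff_le abs_sin_diff_le) auto
    finally show ?thesis by (simp add: a_def algebra_simps)
  qed
  define D where "D n = (\<lambda>k. real k / real (Suc n)) ` {..8 * Suc n}" for n
  define g where "g n = Sup_fin (f ` D n)" for n
  define e where "e n = (1 / real (Suc n)) *\<^sub>R a" for n
  have D: "finite (D n)" "D n \<noteq> {}" for n by (auto simp: D_def)
  have approx: "f t \<le> g n + e n" for t n
  proof -
    obtain t' where t': "0 \<le> t'" "t' < 2 * pi" "cos t = cos t'" "sin t = sin t'"
      using sincos_total_2pi[of "cos t" "sin t"] by auto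
    define k where "k = nat \<lfloor>t' * real (Suc n)\<rfloor>"
    have kle: "real k \<le> t' * real (Suc n)" and kge: "t' * real (Suc n) < real k + 1"
      using t'(1) unfolding k_def by (simp_all add: of_nat_nat)
    have "t' \<le> 8" using t'(2) pi_less_4 by linarith
    then have "t' * real (Suc n) \<le> 8 * real (Suc n)" by (intro mult_right_mono) auto
    with kle have "real k \<le> real (8 * Suc n)" by simp
    then have kD: "real k / real (Suc n) \<in> D n" unfolding D_def by (intro imageI) simp
    have "t' - real k / real (Suc n) = (t' * real (Suc n) - real k) / real (Suc n)"
      by (simp add: field_simps)
    then have "\<bar>t' - real k / real (Suc n)\<bar> \<le> 1 / real (Suc n)"
      using kle kge by (simp add: abs_le_iff divide_right_mono)
    then have "\<bar>t' - real k / real (Suc n)\<bar> *\<^sub>R a \<le> e n"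
      unfolding e_def by (intro scaleR_right_mono a0)
    moreover have "f (real k / real (Suc n)) \<le> g n"
      unfolding g_def using D kD by (intro Sup_fin.coboundedI) auto
    ultimately have "f t' \<le> g n + e n"
      using lip[of t' "real k / real (Suc n)"] add_mono order_trans by blast
    then show ?thesis using t' by (simp add: f_def)
  qed
  have gle: "g n \<le> b" if "\<And>t. f t \<le> b" for n b
    unfolding g_def using D that by (intro Sup_fin.boundedI) auto
  have e_lim: "e \<longlonglongrightarrow> 0"
  proof -
    have "(\<lambda>n. (1 / real (Suc n)) *\<^sub>R a) \<longlonglongrightarrow> 0 *\<^sub>R a"
      using LIMSEQ_inverse_real_of_nat by (intro tendsto_scaleR tendsto_const)
        (simp add: inverse_eq_divide)
    then show ?thesis by (simp add: e_def[abs_def])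
  qed
  have gdiff: "norm (g m - g n) \<le> norm (e m) + norm (e n)" for m n
  proof -
    have e0: "0 \<le> e k" for k using a0 by (simp add: e_def scaleR_nonneg_nonneg)
    have "g m \<le> g n + e n" "g n \<le> g m + e m" by (intro gle approx)+
    then have "g m - g n \<le> e n" "- (g m - g n) \<le> e m" by (simp_all add: algebra_simps)
    then have "g m - g n \<le> e m + e n" "- (g m - g n) \<le> e m + e n"
      using e0[of m] e0[of n] by (meson add_increasing add_increasing2)+
    then have "\<bar>g m - g n\<bar> \<le> e m + e n" by (rule abs_leI)
    then have "\<bar>g m - g n\<bar> \<le> \<bar>e m + e n\<bar>" using abs_ge_self order_trans by blast
    then have "norm (g m - g n) \<le> norm (e m + e n)" by (rule norm_mono_abs)
    also have "\<dots> \<le> norm (e m) + norm (e n)" by (rule norm_triangle_ineq)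
    finally show ?thesis .
  qed
  have "Cauchy g"
  proof (rule metric_CauchyI)
    fix \<epsilon> :: real assume "\<epsilon> > 0"
    then obtain N where N: "\<And>n. n \<ge> N \<Longrightarrow> norm (e n) < \<epsilon> / 2"
      using LIMSEQ_D[OF e_lim, of "\<epsilon> / 2"] by auto
    have "dist (g m) (g n) < \<epsilon>" if "m \<ge> N" "n \<ge> N" for m n
      using gdiff[of m n] N[OF that(1)] N[OF that(2)] by (simp add: dist_norm)
    then show "\<exists>M. \<forall>m\<ge>M. \<forall>n\<ge>M. dist (g m) (g n) < \<epsilon>" by blast
  qed
  then obtain s where s: "g \<longlonglongrightarrow> s" using Cauchy_convergent_iff convergent_def by blast
  have "f t \<le> s" for t
    using LIMSEQ_mono_lattice[OF tendsto_const tendsto_add[OF s e_lim] approx] by simp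
  moreover have "s \<le> b" if "\<And>t. f t \<le> b" for b
    by (rule LIMSEQ_mono_lattice[OF s tendsto_const gle[OF that]])
  ultimately have "isLub UNIV (range f) s" by (simp add: isLub_UNIV_iff)
  then show ?thesis unfolding f_def by blast
qed

lemma isLub_modulus:
  "isLub UNIV (range (\<lambda>\<theta>. cos \<theta> *\<^sub>R real_part z + sin \<theta> *\<^sub>R imag_part z)) (modulus z)"
proof -
  have "\<exists>!s. isLub UNIV (range (\<lambda>\<theta>. cos \<theta> *\<^sub>R real_part z + sin \<theta> *\<^sub>R imag_part z)) s"
    using modulus_exists[of "real_part z" "imag_part z"]
    by (auto simp: isLub_UNIV_iff intro!: antisym)
  then show ?thesis unfolding modulus_def by (rule theI')
qed

lemma modulus_upper: "cos \<theta> *\<^sub>R real_part z + sin \<theta> *\<^sub>R imag_part z \<le> modulus z"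
  using isLub_modulus[of z] unfolding isLub_UNIV_iff by blast

lemma modulus_least:
  "(\<And>\<theta>. cos \<theta> *\<^sub>R real_part z + sin \<theta> *\<^sub>R imag_part z \<le> b) \<Longrightarrow> modulus z \<le> b"
  using isLub_modulus[of z] unfolding isLub_UNIV_iff by blast

lemma abs_real_part_le_modulus: "\<bar>real_part z\<bar> \<le> modulus z"
  using modulus_upper[of 0 z] modulus_upper[of pi z] by (intro abs_leI) auto

lemma abs_imag_part_le_modulus: "\<bar>imag_part z\<bar> \<le> modulus z"
  using modulus_upper[of "pi/2" z] modulus_upper[of "-pi/2" z] by (intro abs_leI) auto

lemma modulus_nonneg: "0 \<le> modulus z"
  using abs_real_part_le_modulus[of z] abs_ge_zero order_trans by blast

lemma modulus_le: "modulus z \<le> \<bar>real_part z\<bar> + \<bar>imag_part z\<bar>"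
proof (rule modulus_least)
  fix \<theta> :: real
  have "cos \<theta> *\<^sub>R real_part z + sin \<theta> *\<^sub>R imag_part z
      \<le> \<bar>cos \<theta>\<bar> *\<^sub>R \<bar>real_part z\<bar> + \<bar>sin \<theta>\<bar> *\<^sub>R \<bar>imag_part z\<bar>"
    by (intro add_mono scaleR_le_abs_scaleR_abs)
  also have "\<dots> \<le> 1 *\<^sub>R \<bar>real_part z\<bar> + 1 *\<^sub>R \<bar>imag_part z\<bar>"
    by (intro add_mono scaleR_right_mono) auto
  finally show "cos \<theta> *\<^sub>R real_part z + sin \<theta> *\<^sub>R imag_part z
      \<le> \<bar>real_part z\<bar> + \<bar>imag_part z\<bar>" by simp
qed

lemma combination_le_modulus:
  "p *\<^sub>R real_part z + q *\<^sub>R imag_part z \<le> sqrt (p\<^sup>2 + q\<^sup>2) *\<^sub>R modulus z"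
proof (cases "p\<^sup>2 + q\<^sup>2 = 0")
  case True
  then show ?thesis by (simp add: sum_power2_eq_zero_iff)
next
  case False
  define r where "r = sqrt (p\<^sup>2 + q\<^sup>2)"
  have r: "r > 0" "r\<^sup>2 = p\<^sup>2 + q\<^sup>2"
    using False unfolding r_def by (auto simp: sum_power2_gt_zero_iff)
  have "(p / r)\<^sup>2 + (q / r)\<^sup>2 = 1"
    using r False by (simp add: power_divide add_divide_distrib[symmetric])
  then obtain t where t: "p / r = cos t" "q / r = sin t" using sincos_total_2pi by metis
  have "r *\<^sub>R (cos t *\<^sub>R real_part z + sin t *\<^sub>R imag_part z) \<le> r *\<^sub>R modulus z"
    using r by (intro scaleR_left_mono modulus_upper) auto
  moreover have "r * cos t = p" "r * sin t = q" using t r by (auto simp: field_simps)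
  ultimately show ?thesis by (simp add: r_def scaleR_add_right)
qed

instantiation complexification :: (banach_lattice) real_normed_vector
begin

definition "(0 :: 'a complexification) = Complexification 0 0"
definition "(z :: 'a complexification) + w =
  Complexification (real_part z + real_part w) (imag_part z + imag_part w)"
definition "- (z :: 'a complexification) = Complexification (- real_part z) (- imag_part z)"
definition "(z :: 'a complexification) - w =
  Complexification (real_part z - real_part w) (imag_part z - imag_part w)"
definition "c *\<^sub>R (z :: 'a complexification) =
  Complexification (c *\<^sub>R real_part z) (c *\<^sub>R imag_part z)"
definition norm_complexification_def: "norm (z :: 'a complexification) = norm (modulus z)"
definition "sgn (z :: 'a complexification) = inverse (norm z) *\<^sub>R z"
definition dist_complexification_def: "dist (z :: 'a complexification) w = norm (z - w)"
definition uniformity_complexification_def: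
  "(uniformity :: ('a complexification \<times> 'a complexification) filter)
     = (INF e\<in>{0<..}. principal {(z, w). dist z w < e})"
definition open_complexification_def:
  "open (U :: 'a complexification set)
     \<longleftrightarrow> (\<forall>z\<in>U. \<forall>\<^sub>F (z', w) in uniformity. z' = z \<longrightarrow> w \<in> U)"

lemma complexification_parts [simp]:
  "real_part 0 = 0" "imag_part 0 = 0"
  "real_part (z + w) = real_part z + real_part w" "imag_part (z + w) = imag_part z + imag_part w"
  "real_part (- z) = - real_part z" "imag_part (- z) = - imag_part z"
  "real_part (z - w) = real_part z - real_part w" "imag_part (z - w) = imag_part z - imag_part w"
  "real_part (c *\<^sub>R z) = c *\<^sub>R real_part z" "imag_part (c *\<^sub>R z) = c *\<^sub>R imag_part z"
  by (simp_all add: zero_complexification_def plus_complexification_def uminus_complexification_def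
      minus_complexification_def scaleR_complexification_def)

lemma norm_real_part_le: "norm (real_part z) \<le> norm z"
  using norm_mono_nonneg[OF abs_ge_zero abs_real_part_le_modulus[of z]]
  by (simp add: norm_abs_lattice norm_complexification_def)

lemma norm_imag_part_le: "norm (imag_part z) \<le> norm z"
  using norm_mono_nonneg[OF abs_ge_zero abs_imag_part_le_modulus[of z]]
  by (simp add: norm_abs_lattice norm_complexification_def)

lemma norm_complexification_le: "norm z \<le> norm (real_part z) + norm (imag_part z)"
proof -
  have "norm z \<le> norm (\<bar>real_part z\<bar> + \<bar>imag_part z\<bar>)"
    unfolding norm_complexification_def by (rule norm_mono_nonneg[OF modulus_nonneg modulus_le])
  also have "\<dots> \<le> norm (real_part z) + norm (imag_part z)"
    using norm_triangle_ineq[of "\<bar>real_part z\<bar>" "\<bar>imag_part z\<bar>"] by (simp add: norm_abs_lattice)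
  finally show ?thesis .
qed

lemma modulus_triangle: "modulus (z + w) \<le> modulus z + modulus w"
proof (rule modulus_least)
  fix \<theta>
  show "cos \<theta> *\<^sub>R real_part (z + w) + sin \<theta> *\<^sub>R imag_part (z + w) \<le> modulus z + modulus w"
    using add_mono[OF modulus_upper[of \<theta> z] modulus_upper[of \<theta> w]] by (simp add: algebra_simps)
qed

lemma norm_scaleR_complexification_le: "norm (c *\<^sub>R z) \<le> \<bar>c\<bar> * norm (z :: 'a complexification)"
proof -
  have "modulus (c *\<^sub>R z) \<le> \<bar>c\<bar> *\<^sub>R modulus z"
  proof (rule modulus_least)
    fix \<theta> :: real
    have "(cos \<theta> * c)\<^sup>2 + (sin \<theta> * c)\<^sup>2 = ((cos \<theta>)\<^sup>2 + (sin \<theta>)\<^sup>2) * c\<^sup>2"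
      by (simp only: power_mult_distrib distrib_right)
    then have "sqrt ((cos \<theta> * c)\<^sup>2 + (sin \<theta> * c)\<^sup>2) = \<bar>c\<bar>" by simp
    then show "cos \<theta> *\<^sub>R real_part (c *\<^sub>R z) + sin \<theta> *\<^sub>R imag_part (c *\<^sub>R z) \<le> \<bar>c\<bar> *\<^sub>R modulus z"
      using combination_le_modulus[of "cos \<theta> * c" z "sin \<theta> * c"] by simp
  qed
  from norm_mono_nonneg[OF modulus_nonneg this] show ?thesis
    by (simp add: norm_complexification_def)
qed

instance
proof
  fix z w v :: "'a complexification" and a b :: real
  show "z + w + v = z + (w + v)" by (rule complexification.expand) (simp add: add.assoc)
  show "z + w = w + z" by (rule complexification.expand) (simp add: add.commute)
  show "0 + z = z" by (rule complexification.expand) simp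
  show "- z + z = 0" by (rule complexification.expand) simp
  show "z - w = z + - w" by (rule complexification.expand) simp
  show "a *\<^sub>R (z + w) = a *\<^sub>R z + a *\<^sub>R w"
    by (rule complexification.expand) (simp add: scaleR_add_right)
  show "(a + b) *\<^sub>R z = a *\<^sub>R z + b *\<^sub>R z"
    by (rule complexification.expand) (simp add: scaleR_add_left)
  show "a *\<^sub>R b *\<^sub>R z = (a * b) *\<^sub>R z" by (rule complexification.expand) simp
  show "1 *\<^sub>R z = z" by (rule complexification.expand) simp
  show "dist z w = norm (z - w)" by (rule dist_complexification_def)
  show "sgn z = inverse (norm z) *\<^sub>R z" by (rule sgn_complexification_def)
  show "(uniformity :: ('a complexification \<times> 'a complexification) filter)
      = (INF e\<in>{0<..}. principal {(z, w). dist z w < e})"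
    by (rule uniformity_complexification_def)
  show "open U \<longleftrightarrow> (\<forall>z\<in>U. \<forall>\<^sub>F (z', w) in uniformity. z' = z \<longrightarrow> w \<in> U)"
    for U :: "'a complexification set"
    by (rule open_complexification_def)
  show "norm z = 0 \<longleftrightarrow> z = 0"
  proof
    assume "norm z = 0"
    then have "norm (real_part z) \<le> 0" "norm (imag_part z) \<le> 0"
      using norm_real_part_le[of z] norm_imag_part_le[of z] by simp_all
    then show "z = 0" by (intro complexification.expand) simp
  next
    assume "z = 0"
    then show "norm z = 0" using norm_complexification_le[of z]
      by (simp add: norm_complexification_def)
  qed
  show "norm (z + w) \<le> norm z + norm w"
    unfolding norm_complexification_def
    by (rule order_trans[OF norm_mono_nonneg[OF modulus_nonneg modulus_triangle] norm_triangle_ineq])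
  show "norm (a *\<^sub>R z) = \<bar>a\<bar> * norm z"
  proof (cases "a = 0")
    case True
    then show ?thesis using norm_scaleR_complexification_le[of a z]
      by (simp add: norm_complexification_def)
  next
    case False
    have "inverse a *\<^sub>R a *\<^sub>R z = z" using False by (intro complexification.expand) simp
    then have "norm z \<le> \<bar>inverse a\<bar> * norm (a *\<^sub>R z)"
      using norm_scaleR_complexification_le[of "inverse a" "a *\<^sub>R z"] by simp
    then have "\<bar>a\<bar> * norm z \<le> norm (a *\<^sub>R z)"
      using False by (simp add: field_simps)
    then show ?thesis using norm_scaleR_complexification_le[of a z] by simp
  qed
qed

end

instance complexification :: (banach_lattice) banach
proof
  fix X :: "nat \<Rightarrow> 'a complexification"
  assume "Cauchy X"
  have "Cauchy (\<lambda>n. real_part (X n))" "Cauchy (\<lambda>n. imag_part (X n))"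
    using \<open>Cauchy X\<close> unfolding Cauchy_def dist_norm
    by (metis norm_real_part_le norm_imag_part_le complexification_parts(7,8) order_le_less_trans)+
  then obtain x y where x: "(\<lambda>n. real_part (X n)) \<longlonglongrightarrow> x" and y: "(\<lambda>n. imag_part (X n)) \<longlonglongrightarrow> y"
    using Cauchy_convergent_iff convergent_def by metis
  have "(\<lambda>n. norm (real_part (X n) - x) + norm (imag_part (X n) - y)) \<longlonglongrightarrow> 0 + 0"
    using x y by (intro tendsto_add tendsto_norm_zero) (simp_all add: LIM_zero)
  then have "(\<lambda>n. norm (real_part (X n) - x) + norm (imag_part (X n) - y)) \<longlonglongrightarrow> 0" by simp
  then have "(\<lambda>n. X n - Complexification x y) \<longlonglongrightarrow> 0"
  proof (rule Lim_null_comparison[rotated])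
    show "\<forall>\<^sub>F n in sequentially. norm (X n - Complexification x y)
        \<le> norm (real_part (X n) - x) + norm (imag_part (X n) - y)"
    proof (rule always_eventually, rule allI)
      fix n
      show "norm (X n - Complexification x y)
          \<le> norm (real_part (X n) - x) + norm (imag_part (X n) - y)"
        using norm_complexification_le[of "X n - Complexification x y"] by simp
    qed
  qed
  then show "convergent X" unfolding convergent_def using LIM_zero_cancel by blast
qed

definition scaleC :: "complex \<Rightarrow> 'a::banach_lattice complexification \<Rightarrow> 'a complexification" where
  "scaleC c z = Complexification (Re c *\<^sub>R real_part z - Im c *\<^sub>R imag_part z)
                                 (Re c *\<^sub>R imag_part z + Im c *\<^sub>R real_part z)"

lemma norm_scaleC: "norm (scaleC c z) = cmod c * norm z"
proof -
  have le: "norm (scaleC c z) \<le> cmod c * norm z" for c and z :: "'a complexification"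
  proof -
    have "modulus (scaleC c z) \<le> cmod c *\<^sub>R modulus z"
    proof (rule modulus_least)
      fix \<theta> :: real
      let ?p = "cos \<theta> * Re c + sin \<theta> * Im c" and ?q = "sin \<theta> * Re c - cos \<theta> * Im c"
      have "?p\<^sup>2 + ?q\<^sup>2 = ((sin \<theta>)\<^sup>2 + (cos \<theta>)\<^sup>2) * ((Re c)\<^sup>2 + (Im c)\<^sup>2)"
        by algebra
      then have "sqrt (?p\<^sup>2 + ?q\<^sup>2) = cmod c" by (simp add: cmod_def)
      then show "cos \<theta> *\<^sub>R real_part (scaleC c z) + sin \<theta> *\<^sub>R imag_part (scaleC c z)
          \<le> cmod c *\<^sub>R modulus z"
        using combination_le_modulus[of ?p z ?q] by (simp add: scaleC_def algebra_simps)
    qed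
    from norm_mono_nonneg[OF modulus_nonneg this] show ?thesis
      by (simp add: norm_complexification_def)
  qed
  show ?thesis
  proof (cases "c = 0")
    case True
    then show ?thesis using le[of c z] by simp
  next
    case False
    have "scaleC (inverse c) (scaleC c z) = scaleC (inverse c * c) z"
      unfolding scaleC_def
      by (rule complexification.expand) (simp add: algebra_simps del: left_inverse)
    also have "\<dots> = z" using False by (intro complexification.expand) (simp add: scaleC_def)
    finally have "norm z \<le> cmod (inverse c) * norm (scaleC c z)"
      using le[of "inverse c" "scaleC c z"] by simp
    then have "norm z \<le> norm (scaleC c z) / cmod c"
      by (simp add: norm_inverse divide_inverse mult.commute)
    then have "cmod c * norm z \<le> norm (scaleC c z)"
      using False by (simp add: pos_le_divide_eq mult.commute)
    then show ?thesis using le[of c z] by simp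
  qed
qed

definition bounded_clinear ::
    "('a::banach_lattice complexification \<Rightarrow> 'b::banach_lattice complexification) \<Rightarrow> bool" where
  "bounded_clinear T \<longleftrightarrow> bounded_linear T \<and> (\<forall>c z. T (scaleC c z) = scaleC c (T z))"

section \<open>Principal ideals and compact operators\<close>

definition principal_ideal :: "'a::banach_lattice \<Rightarrow> 'a set" where
  "principal_ideal u = {f. \<exists>c\<ge>0. \<bar>f\<bar> \<le> c *\<^sub>R u}"

text \<open>The positive cone of the complexification is that of its real part, so the generator \<open>u\<close> is an
  element of the real Banach lattice.\<close>

definition complex_principal_ideal :: "'a::banach_lattice \<Rightarrow> 'a complexification set" where
  "complex_principal_ideal u = {f. \<exists>c\<ge>0. modulus f \<le> c *\<^sub>R u}"

definition compact_operator :: "('a::real_normed_vector \<Rightarrow> 'b::real_normed_vector) \<Rightarrow> bool" where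
  "compact_operator T \<longleftrightarrow> compact (closure (T ` cball 0 1))"

end

theory Submission
  imports Defs
begin

text \<open>The first operator maps the unit ball into an order interval \<open>[- w, w]\<close>, where \<open>w\<close> is a multiple of
\<open>u\<close> (\<open>operator_into_principal_ideal_dominated\<close>, by Baire's theorem). It remains to see that the second
operator \<open>T\<close>, which satisfies \<open>\<bar>T x\<bar> \<le> C \<parallel>x\<parallel> u\<close>, maps order intervals to relatively compact sets.
Conceptually, order intervals are weakly compact by order continuity, \<open>T\<close> is weakly continuous into the
ideal of \<open>u\<close>, which is a space \<open>C(K)\<close>, and the inclusion of this ideal, being a weakly compact operator
on \<open>C(K)\<close>, maps weakly compact sets to compact sets. The proof below is an elementary version that
avoids representation theorems and weak topologies.

Suppose that \<open>f\<^sub>n \<in> [- w, w]\<close> have images under \<open>T\<close> separated by \<open>e\<close>. Order continuity provides a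
positive functional \<open>\<phi>\<close> that controls the norm on an order interval up to a given precision
(\<open>functional_detects_norm\<close>), and a lattice version \<open>q\<close> of the pointwise square on the ideal of \<open>w\<close> for
which \<open>Q = \<phi> \<circ> q\<close> satisfies the parallelogram law (\<open>lattice_square_parallelogram\<close>). In this
pre-Hilbert structure, differences \<open>g\<^sub>i\<close> of the \<open>f\<^sub>n\<close> can be chosen almost orthogonal
(\<open>almost_orthogonal_differences\<close>). Thus signed averages of many \<open>g\<^sub>i\<close> have small norm, uniformly in
the signs. Applying \<open>T\<close> converts this into a bound \<open>\<Sum> \<bar>T g\<^sub>i\<bar> \<le> n \<delta> u\<close> for every set of \<open>n\<close> indices, \<open>n\<close>
large, because the sum of moduli is the supremum of the signed sums. So only boundedly many of the
\<open>\<bar>T g\<^sub>i\<bar>\<close> can exceed \<open>\<delta> u\<close> at the same place; the excesses have order bounded sums and hence tend to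
\<open>0\<close> in norm, by order continuity once more. This contradicts \<open>\<parallel>T g\<^sub>i\<parallel> \<ge> e\<close>
(\<open>image_of_order_bounded_sequence_not_separated\<close>).

The complex case reduces to the real one by splitting operators into real and imaginary parts.\<close>

section \<open>Vector lattice inequalities\<close>

lemma scaleR_abs_lattice:
  fixes x :: "'a::banach_lattice"
  assumes "0 \<le> c"
  shows "\<bar>c *\<^sub>R x\<bar> = c *\<^sub>R \<bar>x\<bar>"
proof (rule antisym)
  have le: "\<bar>d *\<^sub>R y\<bar> \<le> d *\<^sub>R \<bar>y\<bar>" if "0 \<le> d" for d and y :: 'a
    using that scaleR_left_mono[OF abs_ge_self, of d y] scaleR_left_mono[OF abs_ge_minus_self, of d y]
    by (intro abs_leI) simp_all
  show "\<bar>c *\<^sub>R x\<bar> \<le> c *\<^sub>R \<bar>x\<bar>" by (rule le[OF assms])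
  show "c *\<^sub>R \<bar>x\<bar> \<le> \<bar>c *\<^sub>R x\<bar>"
  proof (cases "c = 0")
    case False
    then have "\<bar>x\<bar> \<le> inverse c *\<^sub>R \<bar>c *\<^sub>R x\<bar>"
      using le[of "inverse c" "c *\<^sub>R x"] assms by simp
    from scaleR_left_mono[OF this assms] False show ?thesis by simp
  qed simp
qed

text \<open>This reflects that a sum of moduli is the supremum of the signed sums. For a linear \<open>T\<close>, it converts
bounds on the images of signed combinations into a bound on \<open>\<Sum> \<bar>T g\<bar>\<close>.\<close>

lemma sum_abs_le_if_signed_sums_le:
  fixes y :: "'i \<Rightarrow> 'a::banach_lattice"
  assumes "finite G" and "\<And>A. A \<subseteq> G \<Longrightarrow> sum y A - sum y (G - A) \<le> z"
  shows "(\<Sum>i\<in>G. \<bar>y i\<bar>) \<le> z"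
  using assms
proof (induction G arbitrary: z rule: finite_induct)
  case empty
  from empty[of "{}"] show ?case by simp
next
  case (insert i G)
  have "(\<Sum>j\<in>G. \<bar>y j\<bar>) \<le> z - y i"
  proof (rule insert.IH)
    fix A assume "A \<subseteq> G"
    then have "finite A" "i \<notin> A" "insert i G - insert i A = G - A"
      using insert.hyps finite_subset by auto
    then show "sum y A - sum y (G - A) \<le> z - y i"
      using insert.prems[of "insert i A"] \<open>A \<subseteq> G\<close> by (auto simp: algebra_simps)
  qed
  moreover have "(\<Sum>j\<in>G. \<bar>y j\<bar>) \<le> z + y i"
  proof (rule insert.IH)
    fix A assume "A \<subseteq> G"
    then have "insert i G - A = insert i (G - A)" "i \<notin> G - A" "finite (G - A)"
      using insert.hyps by auto
    then show "sum y A - sum y (G - A) \<le> z + y i"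
      using insert.prems[of A] \<open>A \<subseteq> G\<close> by (auto simp add: algebra_simps)
  qed
  ultimately have "\<bar>y i\<bar> \<le> z - (\<Sum>j\<in>G. \<bar>y j\<bar>)"
    by (intro abs_leI) (simp_all add: algebra_simps)
  then show ?case using insert.hyps by (simp add: algebra_simps)
qed

text \<open>Likewise a sum of positive parts is the supremum of the sums over subsets: in a function space the
relevant subset at a point consists of the indices at which the summand is positive there.\<close>

lemma sum_pos_part_le_if_partial_sums_le:
  fixes y :: "'i \<Rightarrow> 'a::banach_lattice"
  assumes "finite G" and "\<And>A. A \<subseteq> G \<Longrightarrow> sum y A \<le> z"
  shows "(\<Sum>i\<in>G. sup (y i) 0) \<le> z"
  using assms
proof (induction G arbitrary: z rule: finite_induct)
  case empty
  from empty[of "{}"] show ?case by simp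
next
  case (insert i G)
  have "(\<Sum>j\<in>G. sup (y j) 0) \<le> z - y i"
  proof (rule insert.IH)
    fix A assume "A \<subseteq> G"
    then have "finite A" "i \<notin> A"
      using insert.hyps finite_subset by auto
    then show "sum y A \<le> z - y i"
      using insert.prems[of "insert i A"] \<open>A \<subseteq> G\<close> by (auto simp: algebra_simps)
  qed
  moreover have "(\<Sum>j\<in>G. sup (y j) 0) \<le> z"
    using insert.prems by (intro insert.IH) auto
  ultimately have "sup (y i) 0 \<le> z - (\<Sum>j\<in>G. sup (y j) 0)"
    by (intro sup_least) (simp_all add: algebra_simps)
  then show ?case using insert.hyps by (simp add: algebra_simps)
qed

lemma Sup_fin_le_sum:
  fixes h :: "'i \<Rightarrow> 'a::banach_lattice"
  assumes "finite G" "G \<noteq> {}" "\<And>i. i \<in> G \<Longrightarrow> 0 \<le> h i"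
  shows "Sup_fin (h ` G) \<le> sum h G"
proof (rule Sup_fin.boundedI)
  fix x assume "x \<in> h ` G"
  then obtain i where i: "i \<in> G" "x = h i" by blast
  then have "0 \<le> sum h (G - {i})" using assms(3) by (intro sum_nonneg) auto
  then show "x \<le> sum h G" using i assms(1) by (simp add: sum.remove)
qed (use assms in auto)

lemma closed_Collect_le_lattice:
  fixes f g :: "'b::metric_space \<Rightarrow> 'a::banach_lattice"
  assumes "continuous_on UNIV f" "continuous_on UNIV g"
  shows "closed {x. f x \<le> g x}"
  unfolding closed_sequential_limits
proof (intro allI impI; elim conjE)
  fix X l assume X: "\<forall>n. X n \<in> {x. f x \<le> g x}" and lim: "X \<longlonglongrightarrow> l"
  have "(\<lambda>n. f (X n)) \<longlonglongrightarrow> f l" "(\<lambda>n. g (X n)) \<longlonglongrightarrow> g l"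
    using lim by (auto intro: continuous_on_tendsto_compose[OF assms(1)] continuous_on_tendsto_compose[OF assms(2)])
  from LIMSEQ_mono_lattice[OF this] X show "l \<in> {x. f x \<le> g x}" by simp
qed

lemma archimedean_lattice:
  fixes l c :: "'a::banach_lattice"
  assumes "\<And>k. real k *\<^sub>R l \<le> c"
  shows "l \<le> 0"
proof (rule LIMSEQ_mono_lattice[of "\<lambda>_. l"])
  show "(\<lambda>k. inverse (real (Suc k)) *\<^sub>R c) \<longlonglongrightarrow> 0"
    using tendsto_scaleR[OF LIMSEQ_inverse_real_of_nat tendsto_const[of c]] by simp
  show "l \<le> inverse (real (Suc k)) *\<^sub>R c" for k
    using scaleR_left_mono[OF assms[of "Suc k"], of "inverse (real (Suc k))"] by (simp del: of_nat_Suc)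
qed simp

section \<open>Consequences of order continuity\<close>

text \<open>The differences \<open>b - x n\<close>, with \<open>b\<close> an upper bound of the sequence, form a downward directed
  set; by the Archimedean property its infimum is \<open>0\<close>. Order continuity makes these differences small in norm, so the sequence is Cauchy.\<close>

lemma incseq_bounded_convergent:
  fixes x :: "nat \<Rightarrow> 'a::banach_lattice"
  assumes oc: "order_continuous_norm TYPE('a)"
    and inc: "incseq x" and bd: "\<And>n. x n \<le> w"
  shows "\<exists>s. x \<longlonglongrightarrow> s \<and> (\<forall>n. x n \<le> s) \<and> (\<forall>b. (\<forall>n. x n \<le> b) \<longrightarrow> s \<le> b)"
proof -
  define I :: "('a \<times> nat) set" where "I = {(b, n) | b n. \<forall>k. x k \<le> b}"
  define r where "r = (\<lambda>p q :: 'a \<times> nat. fst q \<le> fst p \<and> snd p \<le> snd q)"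
  define d where "d = (\<lambda>p. fst p - x (snd p))"
  have "downward_directed_net I r d"
    unfolding downward_directed_net_def directed_index_def
  proof (intro conjI ballI impI)
    show "I \<noteq> {}" using bd by (auto simp: I_def)
    show "d q \<le> d p" if "r p q" for p q
      using that incseqD[OF inc] unfolding r_def d_def by (intro diff_mono) auto
    show "\<exists>k\<in>I. r i k \<and> r j k" if "i \<in> I" "j \<in> I" for i j
      using that by (intro bexI[of _ "(inf (fst i) (fst j), max (snd i) (snd j))"])
        (auto simp: I_def r_def)
  qed (auto simp: r_def)
  moreover have "isGlb UNIV (d ` I) 0"
    unfolding isGlb_def greatestP_def isLb_def setge_def setle_def
  proof (intro conjI ballI allI impI; clarsimp)
    show "0 \<le> d (b, n)" if "(b, n) \<in> I" for b n
      using that by (auto simp: I_def d_def)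
  next
    fix l assume l: "\<forall>y\<in>I. l \<le> d y"
    have "\<forall>n. x n \<le> w - real k *\<^sub>R l" for k
    proof (induction k)
      case 0
      show ?case using bd by simp
    next
      case (Suc k)
      show ?case
      proof
        fix n
        from Suc have "(w - real k *\<^sub>R l, n) \<in> I" by (auto simp: I_def)
        with l have "l \<le> (w - real k *\<^sub>R l) - x n" by (force simp: d_def)
        then show "x n \<le> w - real (Suc k) *\<^sub>R l" by (simp add: algebra_simps)
      qed
    qed
    then have "real k *\<^sub>R l \<le> w - x 0" for k by (simp add: algebra_simps)
    then show "l \<le> 0" by (rule archimedean_lattice)
  qed
  ultimately have net: "net_tendsto I r d 0" by (rule order_continuous_normD[OF oc])
  have "Cauchy x"
  proof (rule CauchyI')
    fix e :: real assume "0 < e"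
    with net obtain p where p: "p \<in> I" "norm (d p) < e"
      unfolding net_tendsto_def r_def by fastforce
    have "dist (x m) (x n) < e" if "m \<ge> snd p" "n > m" for m n
    proof -
      have "0 \<le> x n - x m" using incseqD[OF inc, of m n] that by simp
      moreover have "x n - x m \<le> d p"
        using p(1) incseqD[OF inc that(1)] by (auto simp: I_def d_def intro!: diff_mono)
      ultimately have "norm (x n - x m) \<le> norm (d p)" by (rule norm_mono_nonneg)
      with p(2) show ?thesis by (simp add: dist_norm norm_minus_commute)
    qed
    then show "\<exists>M. \<forall>m\<ge>M. \<forall>n>m. dist (x m) (x n) < e" by blast
  qed
  then obtain s where s: "x \<longlonglongrightarrow> s" using Cauchy_convergent_iff convergent_def by blast
  moreover have "x n \<le> s" for n
  proof (rule LIMSEQ_mono_lattice[OF tendsto_const LIMSEQ_ignore_initial_segment[OF s, of n]])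
    show "x n \<le> x (m + n)" for m using incseqD[OF inc] by simp
  qed
  moreover have "s \<le> b" if "\<forall>n. x n \<le> b" for b
    using LIMSEQ_mono_lattice[OF s tendsto_const] that by blast
  ultimately show ?thesis by blast
qed

text \<open>Besides the supremum of an order bounded sequence, this records that the suprema of its initial
segments converge to it in norm, so that a positive functional can be estimated on it through finite suprema.\<close>

lemma countable_sup_exists:
  fixes h :: "nat \<Rightarrow> 'a::banach_lattice"
  assumes oc: "order_continuous_norm TYPE('a)" and bd: "\<And>n. h n \<le> w"
  shows "\<exists>s. (\<lambda>n. Sup_fin (h ` {..n})) \<longlonglongrightarrow> s \<and> (\<forall>n. h n \<le> s) \<and>
             (\<forall>b. (\<forall>n. h n \<le> b) \<longrightarrow> s \<le> b)"
proof -
  let ?x = "\<lambda>n. Sup_fin (h ` {..n})"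
  have "incseq ?x"
    by (intro monoI Sup_fin.subset_imp) auto
  moreover have le: "?x n \<le> b" if "\<forall>n. h n \<le> b" for n b
    using that by (intro Sup_fin.boundedI) auto
  ultimately obtain s where s: "?x \<longlonglongrightarrow> s" "\<And>n. ?x n \<le> s" "\<And>b. (\<forall>n. ?x n \<le> b) \<Longrightarrow> s \<le> b"
    using incseq_bounded_convergent[OF oc, of ?x w] bd by blast
  have "h n \<le> s" for n
    using Sup_fin.coboundedI[of "h ` {..n}" "h n"] s(2)[of n] by (auto intro: order_trans)
  with s le show ?thesis by blast
qed

lemma decseq_nonneg_convergent:
  fixes x :: "nat \<Rightarrow> 'a::banach_lattice"
  assumes oc: "order_continuous_norm TYPE('a)" and dec: "decseq x" and nn: "\<And>n. 0 \<le> x n"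
  shows "\<exists>s. x \<longlonglongrightarrow> s \<and> (\<forall>n. s \<le> x n)"
proof -
  have "incseq (\<lambda>n. - x n)" using dec by (simp add: monotone_def)
  from incseq_bounded_convergent[OF oc this, of 0] nn
  obtain s where s: "(\<lambda>n. - x n) \<longlonglongrightarrow> s" "\<And>n. - x n \<le> s"
    by auto
  from tendsto_minus[OF s(1)] have "x \<longlonglongrightarrow> - s" by simp
  moreover have "- s \<le> x n" for n using s(2)[of n] by (simp add: minus_le_iff)
  ultimately show ?thesis by blast
qed

text \<open>The partial sums increase and are bounded, hence converge in norm.\<close>

lemma order_bounded_sums_imp_terms_tendsto_zero:
  fixes h :: "nat \<Rightarrow> 'a::banach_lattice"
  assumes oc: "order_continuous_norm TYPE('a)" and nn: "\<And>n. 0 \<le> h n"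
    and bd: "\<And>n. sum h {..<n} \<le> z"
  shows "h \<longlonglongrightarrow> 0"
proof -
  have "incseq (\<lambda>n. sum h {..<n})" using nn by (intro incseq_SucI) simp
  from incseq_bounded_convergent[OF oc this bd] have "summable h"
    unfolding summable_def sums_def by blast
  then show ?thesis by (rule summable_LIMSEQ_zero)
qed

section \<open>Positive functionals\<close>

definition sublinear_functional :: "('b::real_vector \<Rightarrow> real) \<Rightarrow> bool" where
  "sublinear_functional p \<longleftrightarrow>
     (\<forall>x y. p (x + y) \<le> p x + p y) \<and> (\<forall>c>0. \<forall>x. p (c *\<^sub>R x) \<le> c * p x)"

text \<open>The inequality for \<open>p (c x)\<close> in the definition implies equality, by applying it to \<open>1/c\<close> as well;
inequalities are what passes to infima.\<close>

lemma sublinear_functionalD: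
  assumes "sublinear_functional p"
  shows "p (x + y) \<le> p x + p y" and "0 < c \<Longrightarrow> p (c *\<^sub>R x) = c * p x"
    and "p 0 = 0" and "- p (- x) \<le> p x"
proof -
  show add: "p (x + y) \<le> p x + p y" for x y
    using assms by (simp add: sublinear_functional_def)
  have le: "p (c *\<^sub>R x) \<le> c * p x" if "0 < c" for c x
    using assms that by (simp add: sublinear_functional_def)
  show "p (c *\<^sub>R x) = c * p x" if "0 < c"
    using le[OF that, of x] le[of "inverse c" "c *\<^sub>R x"] that by (simp add: field_simps)
  show "p 0 = 0" using add[of 0 0] le[of "1/2" 0] by simp
  with add[of x "- x"] show "- p (- x) \<le> p x" by simp
qed

text \<open>For sublinear \<open>p\<close> this is the largest sublinear functional below \<open>p\<close> whose value at \<open>- a\<close> is at most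
\<open>- p a\<close>; any linear functional below it agrees with \<open>p\<close> at \<open>a\<close>.\<close>

definition lower_along :: "('b::real_vector \<Rightarrow> real) \<Rightarrow> 'b \<Rightarrow> 'b \<Rightarrow> real" where
  "lower_along p a x = (INF t\<in>{0..}. p (x + t *\<^sub>R a) - t * p a)"

lemma lower_along:
  assumes p: "sublinear_functional p"
  shows "sublinear_functional (lower_along p a)" and "lower_along p a x \<le> p x"
    and "lower_along p a x \<le> p (x + a) - p a"
proof -
  have bdd: "bdd_below ((\<lambda>t. p (x + t *\<^sub>R a) - t * p a) ` {0..})" for x
  proof (rule bdd_belowI2)
    fix t :: real assume "t \<in> {0..}"
    then have "t * p a = p (t *\<^sub>R a)"
      using sublinear_functionalD(2,3)[OF p] by (cases "t = 0") auto
    also have "\<dots> \<le> p (x + t *\<^sub>R a) + p (- x)"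
      using sublinear_functionalD(1)[OF p, of "x + t *\<^sub>R a" "- x"] by simp
    finally show "- p (- x) \<le> p (x + t *\<^sub>R a) - t * p a" by simp
  qed
  have lower: "lower_along p a x \<le> p (x + t *\<^sub>R a) - t * p a" if "0 \<le> t" for t x
    unfolding lower_along_def using bdd that by (intro cINF_lower) auto
  have greatest: "z \<le> lower_along p a x"
    if "\<And>t. 0 \<le> t \<Longrightarrow> z \<le> p (x + t *\<^sub>R a) - t * p a" for z x
    unfolding lower_along_def using that by (intro cINF_greatest) auto
  show "lower_along p a x \<le> p x" using lower[of 0 x] by simp
  show "lower_along p a x \<le> p (x + a) - p a" using lower[of 1 x] by simp
  show "sublinear_functional (lower_along p a)"
    unfolding sublinear_functional_def
  proof (intro conjI allI impI)
    fix x y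
    have "lower_along p a (x + y) - (p (y + s *\<^sub>R a) - s * p a) \<le> lower_along p a x"
      if "0 \<le> s" for s
    proof (rule greatest)
      fix t :: real assume "0 \<le> t"
      have "lower_along p a (x + y) \<le> p ((x + y) + (t + s) *\<^sub>R a) - (t + s) * p a"
        using that \<open>0 \<le> t\<close> by (intro lower) simp
      also have "p ((x + y) + (t + s) *\<^sub>R a) = p ((x + t *\<^sub>R a) + (y + s *\<^sub>R a))"
        by (simp add: algebra_simps)
      also have "\<dots> \<le> p (x + t *\<^sub>R a) + p (y + s *\<^sub>R a)"
        by (rule sublinear_functionalD(1)[OF p])
      finally show "lower_along p a (x + y) - (p (y + s *\<^sub>R a) - s * p a)
          \<le> p (x + t *\<^sub>R a) - t * p a"
        by (simp add: algebra_simps)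
    qed
    then have "lower_along p a (x + y) - lower_along p a x \<le> lower_along p a y"
      by (intro greatest) (simp add: algebra_simps)
    then show "lower_along p a (x + y) \<le> lower_along p a x + lower_along p a y" by simp
  next
    fix c :: real and x assume "0 < c"
    have "inverse c * lower_along p a (c *\<^sub>R x) \<le> lower_along p a x"
    proof (rule greatest)
      fix t :: real assume "0 \<le> t"
      have "lower_along p a (c *\<^sub>R x) \<le> p (c *\<^sub>R x + (c * t) *\<^sub>R a) - (c * t) * p a"
        using \<open>0 < c\<close> \<open>0 \<le> t\<close> by (intro lower) simp
      also have "\<dots> = c * (p (x + t *\<^sub>R a) - t * p a)"
        using sublinear_functionalD(2)[OF p \<open>0 < c\<close>, of "x + t *\<^sub>R a"] by (simp add: algebra_simps)
      finally show "inverse c * lower_along p a (c *\<^sub>R x) \<le> p (x + t *\<^sub>R a) - t * p a"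
        using \<open>0 < c\<close> by (simp add: field_simps)
    qed
    then show "lower_along p a (c *\<^sub>R x) \<le> c * lower_along p a x"
      using \<open>0 < c\<close> by (simp add: field_simps)
  qed
qed

text \<open>Minimality forces \<open>lower_along m a = m\<close> for every \<open>a\<close>, which is the missing half of additivity.\<close>

lemma minimal_sublinear_functional_linear:
  assumes m: "sublinear_functional m"
    and min: "\<And>q. sublinear_functional q \<Longrightarrow> (\<And>x. q x \<le> m x) \<Longrightarrow> q = m"
  shows "linear m"
proof -
  have add: "m (x + a) = m x + m a" for x a
  proof (rule antisym)
    have "lower_along m a = m"
      by (intro min lower_along[OF m])
    with lower_along(3)[OF m, of a x] show "m x + m a \<le> m (x + a)" by simp
  qed (rule sublinear_functionalD(1)[OF m])
  have neg: "m (- x) = - m x" for x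
    using add[of x "- x"] sublinear_functionalD(3)[OF m] by simp
  have "m (c *\<^sub>R x) = c * m x" for c x
  proof (cases c "0 :: real" rule: linorder_cases)
    case less
    with sublinear_functionalD(2)[OF m, of "- c" x] show ?thesis by (simp add: neg)
  qed (use sublinear_functionalD[OF m] in auto)
  with add show ?thesis by (intro linearI) auto
qed

text \<open>Hahn--Banach in the form of Zorn's lemma for sublinear functionals: the pointwise infimum of a chain
is sublinear, and it is finite since every sublinear \<open>q \<le> p\<close> satisfies \<open>- p (- x) \<le> q x\<close>.\<close>

lemma linear_below_sublinear_functional:
  assumes p: "sublinear_functional p"
  shows "\<exists>f. linear f \<and> (\<forall>x. f x \<le> p x)"
proof -
  let ?A = "{q. sublinear_functional q \<and> (\<forall>x. q x \<le> p x)}"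
  let ?P = "\<lambda>q q'. \<forall>x. q' x \<le> q x"
  have "\<exists>m\<in>?A. \<forall>q\<in>?A. ?P m q \<longrightarrow> q = m"
  proof (rule predicate_Zorn)
    show "partial_order_on ?A (relation_of ?P ?A)"
      by (rule partial_order_on_relation_ofI) (auto simp: fun_eq_iff intro: order_trans antisym)
    fix C assume "C \<in> Chains (relation_of ?P ?A)"
    then have CA: "C \<subseteq> ?A" and chain: "\<And>q q'. q \<in> C \<Longrightarrow> q' \<in> C \<Longrightarrow> ?P q q' \<or> ?P q' q"
      unfolding Chains_def relation_of_def by auto
    show "\<exists>u\<in>?A. \<forall>q\<in>C. ?P q u"
    proof (cases "C = {}")
      case True
      with p show ?thesis by (intro bexI[of _ p]) auto
    next
      case False
      define u where "u x = (INF q\<in>C. q x)" for x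
      have "- p (- x) \<le> q x" if "q \<in> C" for q x
      proof -
        have "- p (- x) \<le> - q (- x)" using CA that by auto
        also have "\<dots> \<le> q x" using CA that by (intro sublinear_functionalD(4)) auto
        finally show ?thesis .
      qed
      then have lower: "u x \<le> q x" if "q \<in> C" for q x
        unfolding u_def using that by (intro cINF_lower bdd_belowI2) auto
      have greatest: "z \<le> u x" if "\<And>q. q \<in> C \<Longrightarrow> z \<le> q x" for z x
        unfolding u_def using that False by (intro cINF_greatest) auto
      have "sublinear_functional u"
        unfolding sublinear_functional_def
      proof (intro conjI allI impI)
        fix x y
        have "u (x + y) \<le> q x + q' y" if qq: "q \<in> C" "q' \<in> C" for q q'
        proof -
          obtain r where r: "r \<in> C" "r x \<le> q x" "r y \<le> q' y"
            using chain[OF qq] qq by blast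
          have "u (x + y) \<le> r (x + y)" by (rule lower[OF r(1)])
          also have "\<dots> \<le> r x + r y" using CA r(1) by (intro sublinear_functionalD(1)) auto
          finally show ?thesis using r by simp
        qed
        then have "u (x + y) - q' y \<le> u x" if "q' \<in> C" for q'
          using that by (intro greatest) (simp add: algebra_simps)
        then have "u (x + y) - u x \<le> u y"
          by (intro greatest) (simp add: algebra_simps)
        then show "u (x + y) \<le> u x + u y" by simp
      next
        fix c :: real and x assume "0 < c"
        have "inverse c * u (c *\<^sub>R x) \<le> u x"
        proof (rule greatest)
          fix q assume "q \<in> C"
          then have "q (c *\<^sub>R x) = c * q x" using CA \<open>0 < c\<close> by (intro sublinear_functionalD(2)) auto
          with lower[OF \<open>q \<in> C\<close>, of "c *\<^sub>R x"] \<open>0 < c\<close> show "inverse c * u (c *\<^sub>R x) \<le> q x"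
            by (simp add: field_simps)
        qed
        then show "u (c *\<^sub>R x) \<le> c * u x" using \<open>0 < c\<close> by (simp add: field_simps)
      qed
      moreover have "u x \<le> p x" for x
      proof -
        obtain q where "q \<in> C" using False by blast
        with lower[of q x] CA show ?thesis by (auto intro: order_trans)
      qed
      ultimately show ?thesis using lower by blast
    qed
  qed
  then obtain m where m: "sublinear_functional m" "\<And>x. m x \<le> p x"
    and min: "\<And>q. sublinear_functional q \<Longrightarrow> (\<forall>x. q x \<le> p x) \<Longrightarrow> \<forall>x. q x \<le> m x \<Longrightarrow> q = m"
    by blast
  have "linear m"
  proof (rule minimal_sublinear_functional_linear[OF m(1)])
    fix q assume "sublinear_functional q" "\<And>x. q x \<le> m x"
    with m(2) show "q = m" by (intro min) (auto intro: order_trans)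
  qed
  with m(2) show ?thesis by blast
qed

definition positive_functional :: "('a::banach_lattice \<Rightarrow> real) \<Rightarrow> bool" where
  "positive_functional \<phi> \<longleftrightarrow> bounded_linear \<phi> \<and> (\<forall>x\<ge>0. 0 \<le> \<phi> x)"

lemma positive_functionalD:
  assumes "positive_functional \<phi>"
  shows "bounded_linear \<phi>" "0 \<le> x \<Longrightarrow> 0 \<le> \<phi> x" "x \<le> y \<Longrightarrow> \<phi> x \<le> \<phi> y"
proof -
  show lin: "bounded_linear \<phi>" and pos: "0 \<le> x \<Longrightarrow> 0 \<le> \<phi> x" for x
    using assms by (auto simp: positive_functional_def)
  show "x \<le> y \<Longrightarrow> \<phi> x \<le> \<phi> y" using pos[of "y - x"] linear_diff[OF bounded_linear.linear[OF lin]] by simp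
qed

text \<open>Dominating by \<open>x \<mapsto> \<parallel>x\<^sup>+\<parallel>\<close> instead of the norm makes the functional positive, because this
vanishes at \<open>- x\<close> for \<open>x \<ge> 0\<close>. Lowering along \<open>h\<close> first forces the value at \<open>h\<close>.\<close>

lemma positive_norming_functional_exists:
  fixes h :: "'a::banach_lattice"
  assumes h: "0 \<le> h"
  shows "\<exists>\<phi>. positive_functional \<phi> \<and> (\<forall>x. \<phi> x \<le> norm x) \<and> \<phi> h = norm h"
proof -
  define p where "p x = norm (sup x 0)" for x :: 'a
  have p: "sublinear_functional p"
    unfolding sublinear_functional_def
  proof (intro conjI allI impI)
    fix x y :: 'a
    have "norm (sup (x + y) 0) \<le> norm (sup x 0 + sup y 0)"
      by (intro norm_mono_nonneg sup_least add_mono add_nonneg_nonneg) auto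
    also have "\<dots> \<le> norm (sup x 0) + norm (sup y 0)" by (rule norm_triangle_ineq)
    finally show "p (x + y) \<le> p x + p y" by (simp add: p_def)
  next
    fix c :: real and x :: 'a assume "0 < c"
    then have "norm (sup (c *\<^sub>R x) 0) \<le> norm (c *\<^sub>R sup x 0)"
      by (intro norm_mono_nonneg sup_least scaleR_left_mono scaleR_nonneg_nonneg) auto
    with \<open>0 < c\<close> show "p (c *\<^sub>R x) \<le> c * p x" by (simp add: p_def)
  qed
  obtain f where f: "linear f" "\<And>x. f x \<le> lower_along p h x"
    using linear_below_sublinear_functional[OF lower_along(1)[OF p]] by blast
  have fp: "f x \<le> p x" for x using f(2) lower_along(2)[OF p] by (rule order_trans)
  have pn: "p x \<le> norm x" for x
  proof -
    have "norm (sup x 0) \<le> norm \<bar>x\<bar>"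
      by (intro norm_mono_nonneg sup_least abs_ge_self) auto
    then show ?thesis by (simp add: p_def norm_abs_lattice)
  qed
  have fn: "f x \<le> norm x" for x using fp pn by (rule order_trans)
  have neg: "f (- x) = - f x" for x using f(1) by (rule linear_neg)
  have "\<bar>f x\<bar> \<le> norm x" for x
    using fn[of x] fn[of "- x"] by (simp add: neg abs_le_iff)
  then have "bounded_linear f"
    by (intro bounded_linear.intro f(1) bounded_linear_axioms.intro exI[of _ 1]) auto
  moreover have "0 \<le> f x" if "0 \<le> x" for x
  proof -
    have "sup (- x) 0 = 0" using that by (simp add: sup_absorb2)
    then show ?thesis using fp[of "- x"] by (simp add: neg p_def)
  qed
  moreover have "f h = norm h"
  proof (rule antisym[OF fn])
    have "f (- h) \<le> p (- h + h) - p h" using f(2) lower_along(3)[OF p] by (rule order_trans)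
    moreover have "p h = norm h" using h by (simp add: p_def sup_absorb1)
    ultimately show "norm h \<le> f h" using sublinear_functionalD(3)[OF p] by (simp add: neg)
  qed
  ultimately show ?thesis using fn unfolding positive_functional_def by blast
qed

text \<open>On an order interval, smallness under one suitable positive functional forces smallness in norm,
up to a prescribed precision \<open>\<epsilon>\<close>; this scalar measure of size replaces the integral of an
\<open>L\<^sup>1\<close>-representation.

If it fails, construct alternately \<open>h\<^sub>n \<in> [0, w]\<close> of norm at least \<open>\<epsilon>\<close>, almost annihilated by all
earlier functionals, and a positive functional \<open>\<phi>\<^sub>n\<close> of norm at most \<open>1\<close> norming \<open>h\<^sub>n\<close>. The suprema
\<open>s\<^sub>n\<close> of the tails decrease and converge in norm to some \<open>t\<close>. Each \<open>\<phi>\<^sub>i\<close> is nonpositive at \<open>t\<close>,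
since for \<open>n > i\<close> the value \<open>\<phi>\<^sub>i s\<^sub>n\<close> is at most a geometric tail; but \<open>\<phi>\<^sub>n s\<^sub>n \<ge> \<phi>\<^sub>n h\<^sub>n \<ge> \<epsilon>\<close>, so \<open>\<parallel>s\<^sub>n - t\<parallel> \<ge> \<epsilon>\<close> for all \<open>n\<close>.\<close>

lemma functional_detects_norm:
  fixes w :: "'a::banach_lattice"
  assumes oc: "order_continuous_norm TYPE('a)" and "0 < \<epsilon>"
  shows "\<exists>\<phi> \<eta>. positive_functional \<phi> \<and> 0 < \<eta> \<and>
           (\<forall>h. 0 \<le> h \<longrightarrow> h \<le> w \<longrightarrow> \<phi> h < \<eta> \<longrightarrow> norm h < \<epsilon>)"
proof (rule ccontr)
  assume neg: "\<not> ?thesis"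
  have ex: "\<exists>h. 0 \<le> h \<and> h \<le> w \<and> \<phi> h < \<eta> \<and> \<epsilon> \<le> norm h"
    if "positive_functional \<phi>" "0 < \<eta>" for \<phi> \<eta>
    using neg that by (meson not_le)
  \<comment> \<open>The \<open>n\<close>-th choice is a pair: the element \<open>h\<^sub>n\<close> and a functional norming it.\<close>
  define step where "step f n p \<longleftrightarrow>
      0 \<le> fst p \<and> fst p \<le> w \<and> \<epsilon> \<le> norm (fst p) \<and> (\<forall>i<n. snd (f i) (fst p) \<le> (1/2)^n) \<and>
      positive_functional (snd p) \<and> (\<forall>x. snd p x \<le> norm x) \<and> snd p (fst p) = norm (fst p)"
    for f :: "nat \<Rightarrow> 'a \<times> ('a \<Rightarrow> real)" and n p
  have "\<exists>f. \<forall>n. step f n (f n)"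
  proof (rule dependent_wellorder_choice)
    show "step f n p = step g n p" if "\<And>i. i < n \<Longrightarrow> f i = g i" for p f g n
      using that by (simp add: step_def)
    fix n and f :: "nat \<Rightarrow> 'a \<times> ('a \<Rightarrow> real)"
    assume prev: "\<And>i. i < n \<Longrightarrow> step f i (f i)"
    then have pos: "positive_functional (snd (f i))" if "i < n" for i
      using that unfolding step_def by blast
    let ?\<psi> = "\<lambda>x. \<Sum>i<n. snd (f i) x"
    have "positive_functional ?\<psi>"
      unfolding positive_functional_def
      using positive_functionalD(1,2)[OF pos] by (intro conjI allI impI bounded_linear_sum sum_nonneg) auto
    from ex[OF this, of "(1/2)^n"]
    obtain h where h: "0 \<le> h" "h \<le> w" "?\<psi> h < (1/2)^n" "\<epsilon> \<le> norm h" by auto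
    have "snd (f i) h \<le> (1/2)^n" if "i < n" for i
    proof -
      have "snd (f i) h \<le> ?\<psi> h"
        using that positive_functionalD(2)[OF pos h(1)] by (intro member_le_sum) auto
      with h(3) show ?thesis by simp
    qed
    moreover obtain \<phi> where "positive_functional \<phi>" "\<forall>x. \<phi> x \<le> norm x" "\<phi> h = norm h"
      using positive_norming_functional_exists[OF h(1)] by blast
    ultimately show "\<exists>p. step f n p" using h by (intro exI[of _ "(h, \<phi>)"]) (simp add: step_def)
  qed
  then obtain f where f: "\<And>n. step f n (f n)" by blast
  define h where "h n = fst (f n)" for n
  define \<phi> where "\<phi> n = snd (f n)" for n
  have h: "0 \<le> h n" "h n \<le> w" "\<epsilon> \<le> norm (h n)" "i < n \<Longrightarrow> \<phi> i (h n) \<le> (1/2)^n" for i n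
    using f[of n] by (auto simp: step_def h_def \<phi>_def)
  have \<phi>: "positive_functional (\<phi> n)" "\<phi> n x \<le> norm x" "\<phi> n (h n) = norm (h n)" for n x
    using f[of n] by (auto simp: step_def h_def \<phi>_def)
  have lin: "bounded_linear (\<phi> n)" for n using \<phi>(1) by (rule positive_functionalD)
  have "\<exists>s. (\<lambda>k. Sup_fin ((\<lambda>k. h (n + k)) ` {..k})) \<longlonglongrightarrow> s \<and> (\<forall>k. h (n + k) \<le> s) \<and>
          (\<forall>b. (\<forall>k. h (n + k) \<le> b) \<longrightarrow> s \<le> b)" for n
    using h(2) by (intro countable_sup_exists[OF oc])
  then obtain s where s_lim: "\<And>n. (\<lambda>k. Sup_fin ((\<lambda>k. h (n + k)) ` {..k})) \<longlonglongrightarrow> s n"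
    and s_ge: "\<And>n k. h (n + k) \<le> s n" and s_least: "\<And>n b. (\<And>k. h (n + k) \<le> b) \<Longrightarrow> s n \<le> b"
    by metis
  have "decseq s"
  proof (rule decseq_SucI, rule s_least)
    show "h (Suc n + k) \<le> s n" for n k using s_ge[of n "Suc k"] by simp
  qed
  moreover have "0 \<le> s n" for n using h(1)[of n] s_ge[of n 0] by simp
  ultimately obtain t where t: "s \<longlonglongrightarrow> t" "\<And>n. t \<le> s n"
    using decseq_nonneg_convergent[OF oc, of s] by blast
  have \<phi>s: "\<phi> i (s n) \<le> 2 * (1/2)^n" if "i < n" for i n
  proof (rule LIMSEQ_le_const2[OF bounded_linear.tendsto[OF lin s_lim]], intro exI allI impI)
    fix k :: nat
    have "\<phi> i (Sup_fin ((\<lambda>k. h (n + k)) ` {..k})) \<le> \<phi> i (\<Sum>j\<le>k. h (n + j))"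
      using h(1) by (intro positive_functionalD(3)[OF \<phi>(1)] Sup_fin_le_sum) auto
    also have "\<dots> = (\<Sum>j\<le>k. \<phi> i (h (n + j)))"
      by (rule linear_sum[OF bounded_linear.linear[OF lin]])
    also have "\<dots> \<le> (\<Sum>j\<le>k. (1/2)^n * (1/2)^j)"
      using that h(4)[of i] by (intro sum_mono) (simp add: power_add[symmetric])
    also have "\<dots> = (1/2)^n * (\<Sum>j\<le>k. (1/2)^j)" by (rule sum_distrib_left[symmetric])
    also have "\<dots> \<le> (1/2)^n * 2"
      by (intro mult_left_mono) (simp_all add: sum_gp0)
    finally show "\<phi> i (Sup_fin ((\<lambda>k. h (n + k)) ` {..k})) \<le> 2 * (1/2)^n" by simp
  qed
  have "\<phi> i t \<le> 0" for i
  proof (rule LIMSEQ_le_const)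
    show "(\<lambda>n. 2 * (1/2)^n :: real) \<longlonglongrightarrow> 0"
      by (intro tendsto_mult_right_zero LIMSEQ_power_zero) simp
    have "\<phi> i t \<le> 2 * (1/2)^n" if "Suc i \<le> n" for n
      using \<phi>s[of i n] positive_functionalD(3)[OF \<phi>(1) t(2), of i n] that by simp
    then show "\<exists>N. \<forall>n\<ge>N. \<phi> i t \<le> 2 * (1/2)^n" by blast
  qed
  have "\<epsilon> \<le> norm (s n - t)" for n
  proof -
    have "\<epsilon> \<le> \<phi> n (h n)" using h(3) \<phi>(3) by simp
    also have "\<dots> \<le> \<phi> n (s n)" using s_ge[of n 0] by (intro positive_functionalD(3)[OF \<phi>(1)]) simp
    also have "\<dots> \<le> \<phi> n (s n) - \<phi> n t" using \<open>\<phi> n t \<le> 0\<close> by simp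
    also have "\<dots> = \<phi> n (s n - t)" by (rule linear_diff[OF bounded_linear.linear[OF lin], symmetric])
    also have "\<dots> \<le> norm (s n - t)" by (rule \<phi>(2))
    finally show ?thesis .
  qed
  moreover have "\<exists>n. norm (s n - t) < \<epsilon>" using LIMSEQ_D[OF t(1) \<open>0 < \<epsilon>\<close>] by blast
  ultimately show False by (meson not_le)
qed

section \<open>Operators into a principal ideal\<close>

text \<open>The sets \<open>{x. \<bar>T x\<bar> \<le> n u}\<close> are closed and cover the space, so by Baire's theorem one of them
contains a ball; translating the ball to the origin gives the estimate. (This amounts to the closed
graph theorem for \<open>T\<close> as a map into the ideal with its order unit norm.)\<close>

lemma operator_into_principal_ideal_dominated:
  fixes T :: "'b::banach \<Rightarrow> 'a::banach_lattice"
  assumes T: "bounded_linear T" and range: "range T \<subseteq> principal_ideal u" and u: "0 \<le> u"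
  shows "\<exists>C>0. \<forall>x. \<bar>T x\<bar> \<le> (C * norm x) *\<^sub>R u"
proof -
  define F where "F n = {x. \<bar>T x\<bar> \<le> real n *\<^sub>R u}" for n
  have lin: "linear T" using T by (rule bounded_linear.linear)
  have F_closed: "closed (F n)" for n
  proof -
    have "F n = {x. T x \<le> real n *\<^sub>R u} \<inter> {x. - T x \<le> real n *\<^sub>R u}"
      unfolding F_def using abs_ge_self abs_ge_minus_self order_trans by (blast intro: abs_leI)
    moreover have "continuous_on UNIV T" using T by (rule linear_continuous_on)
    ultimately show ?thesis
      by (auto intro!: closed_Int closed_Collect_le_lattice continuous_intros)
  qed
  have F_cover: "x \<in> (\<Union>n. F n)" for x
  proof -
    obtain c where c: "\<bar>T x\<bar> \<le> c *\<^sub>R u" using range by (auto simp: principal_ideal_def)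
    obtain n :: nat where "c \<le> real n" using real_arch_simple by blast
    then have "c *\<^sub>R u \<le> real n *\<^sub>R u" using u by (rule scaleR_right_mono)
    with c have "x \<in> F n" by (simp add: F_def)
    then show ?thesis by blast
  qed
  have "\<exists>n. interior (F n) \<noteq> {}"
  proof (rule ccontr)
    assume "\<not> ?thesis"
    then have "euclidean interior_of \<Union> (range F) = {}"
      using F_closed
      by (intro Baire_category_alt) (auto simp: completely_metrizable_space_euclidean)
    moreover have "\<Union> (range F) = UNIV" using F_cover by blast
    ultimately show False by simp
  qed
  then obtain n x0 r where r: "0 < r" "cball x0 r \<subseteq> F n"
    by (metis all_not_in_conv interior_subset mem_interior_cball)
  have "\<bar>T x\<bar> \<le> ((2 * (real n + 1) / r) * norm x) *\<^sub>R u" for x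
  proof (cases "x = 0")
    case True
    then show ?thesis using linear_0[OF lin] by simp
  next
    case False
    define a where "a = r / norm x"
    have a: "0 < a" using False r(1) by (simp add: a_def)
    have "norm (a *\<^sub>R x) = r" using False r(1) by (simp add: a_def)
    then have "x0 + a *\<^sub>R x \<in> F n" "x0 \<in> F n"
      using r by (auto simp: dist_norm)
    then have "\<bar>T (x0 + a *\<^sub>R x)\<bar> + \<bar>T x0\<bar> \<le> real n *\<^sub>R u + real n *\<^sub>R u"
      unfolding F_def by (intro add_mono) auto
    moreover have "\<bar>T (x0 + a *\<^sub>R x) - T x0\<bar> \<le> \<bar>T (x0 + a *\<^sub>R x)\<bar> + \<bar>T x0\<bar>" by (rule abs_triangle_ineq4)
    moreover have "T (x0 + a *\<^sub>R x) - T x0 = a *\<^sub>R T x"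
      by (simp add: linear_add[OF lin] linear_scale[OF lin])
    ultimately have "a *\<^sub>R \<bar>T x\<bar> \<le> (2 * real n) *\<^sub>R u"
      using a by (simp add: scaleR_abs_lattice scaleR_add_left[symmetric])
    also have "\<dots> \<le> (2 * (real n + 1)) *\<^sub>R u" using u by (intro scaleR_right_mono) auto
    finally have "inverse a *\<^sub>R a *\<^sub>R \<bar>T x\<bar> \<le> inverse a *\<^sub>R (2 * (real n + 1)) *\<^sub>R u"
      using a by (intro scaleR_left_mono) auto
    moreover have "inverse a * (2 * (real n + 1)) = (2 * (real n + 1) / r) * norm x"
      by (simp add: a_def)
    ultimately show ?thesis using a by simp
  qed
  then show ?thesis using r(1) by (intro exI[of _ "2 * (real n + 1) / r"]) simp
qed

lemma unit_ball_image_in_order_interval: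
  fixes T :: "'b::banach \<Rightarrow> 'a::banach_lattice"
  assumes T: "bounded_linear T" and range: "range T \<subseteq> principal_ideal u" and u: "0 \<le> u"
  shows "\<exists>C\<ge>0. \<forall>x\<in>cball 0 1. \<bar>T x\<bar> \<le> C *\<^sub>R u"
proof -
  obtain C where C: "0 < C" "\<And>x. \<bar>T x\<bar> \<le> (C * norm x) *\<^sub>R u"
    using operator_into_principal_ideal_dominated[OF assms] by blast
  have "\<bar>T x\<bar> \<le> C *\<^sub>R u" if "x \<in> cball 0 1" for x
  proof -
    have "(C * norm x) *\<^sub>R u \<le> C *\<^sub>R u"
      using that C(1) by (intro scaleR_right_mono u mult_left_le) auto
    with C(2)[of x] show ?thesis by (rule order_trans)
  qed
  with C(1) show ?thesis by (intro exI[of _ C]) auto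
qed

section \<open>The square relative to an order unit\<close>

lemma subspace_principal_ideal: "subspace (principal_ideal u)"
proof (rule subspaceI)
  show "0 \<in> principal_ideal u" by (auto simp: principal_ideal_def)
next
  fix x y assume "x \<in> principal_ideal u" "y \<in> principal_ideal u"
  then obtain c d where "0 \<le> c" "\<bar>x\<bar> \<le> c *\<^sub>R u" "0 \<le> d" "\<bar>y\<bar> \<le> d *\<^sub>R u"
    by (auto simp: principal_ideal_def)
  moreover from this have "\<bar>x + y\<bar> \<le> (c + d) *\<^sub>R u"
    using order_trans[OF abs_triangle_ineq add_mono] by (simp add: scaleR_add_left)
  ultimately show "x + y \<in> principal_ideal u"
    unfolding principal_ideal_def by (auto intro!: exI[of _ "c + d"])
next
  fix a :: real and x assume "x \<in> principal_ideal u"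
  then obtain c where c: "0 \<le> c" "\<bar>x\<bar> \<le> c *\<^sub>R u" by (auto simp: principal_ideal_def)
  have "\<bar>a *\<^sub>R x\<bar> \<le> \<bar>a\<bar> *\<^sub>R \<bar>x\<bar>"
    using scaleR_le_abs_scaleR_abs[of a x] scaleR_le_abs_scaleR_abs[of "- a" x] by (intro abs_leI) simp_all
  also have "\<dots> \<le> (\<bar>a\<bar> * c) *\<^sub>R u" using scaleR_left_mono[OF c(2), of "\<bar>a\<bar>"] by simp
  finally show "a *\<^sub>R x \<in> principal_ideal u"
    using c(1) unfolding principal_ideal_def by (auto intro!: exI[of _ "\<bar>a\<bar> * c"])
qed

text \<open>In a space of functions with \<open>u = 1\<close> this is the pointwise square: \<open>f\<^sup>2\<close> is the supremum of its tangents
\<open>2 t f - t\<^sup>2\<close>. Rational slopes suffice and make the supremum countable, so that it exists under order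
continuity. Since the rationals are closed under \<open>(t, s) \<mapsto> ((t + s) / 2, (t - s) / 2)\<close>, the
parallelogram law is unaffected.\<close>

definition lattice_square :: "'a::banach_lattice \<Rightarrow> 'a \<Rightarrow> 'a" where
  "lattice_square u f = (THE s. isLub UNIV ((\<lambda>t. (2 * t) *\<^sub>R f - t\<^sup>2 *\<^sub>R u) ` \<rat>) s)"

context
  fixes u :: "'a::banach_lattice"
  assumes oc: "order_continuous_norm TYPE('a)" and u: "0 \<le> u"
begin

lemma tangent_le:
  assumes f: "\<bar>f\<bar> \<le> c *\<^sub>R u"
  shows "(2 * t) *\<^sub>R f - t\<^sup>2 *\<^sub>R u \<le> c\<^sup>2 *\<^sub>R u"
proof -
  have "(2 * t) *\<^sub>R f \<le> \<bar>2 * t\<bar> *\<^sub>R \<bar>f\<bar>" by (rule scaleR_le_abs_scaleR_abs)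
  also have "\<dots> \<le> \<bar>2 * t\<bar> *\<^sub>R (c *\<^sub>R u)" by (intro scaleR_left_mono f) simp
  finally have "(2 * t) *\<^sub>R f \<le> (2 * \<bar>t\<bar> * c) *\<^sub>R u" by (simp add: abs_mult)
  then have "(2 * t) *\<^sub>R f - t\<^sup>2 *\<^sub>R u \<le> (2 * \<bar>t\<bar> * c) *\<^sub>R u - t\<^sup>2 *\<^sub>R u" by (rule diff_right_mono)
  also have "\<dots> = (2 * \<bar>t\<bar> * c - t\<^sup>2) *\<^sub>R u" by (simp add: scaleR_diff_left)
  also have "\<dots> \<le> c\<^sup>2 *\<^sub>R u"
  proof (rule scaleR_right_mono[OF _ u])
    have "0 \<le> (\<bar>t\<bar> - c)\<^sup>2" by simp
    then show "2 * \<bar>t\<bar> * c - t\<^sup>2 \<le> c\<^sup>2" by (simp add: power2_diff)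
  qed
  finally show ?thesis .
qed

lemma isLub_lattice_square:
  assumes "f \<in> principal_ideal u"
  shows "isLub UNIV ((\<lambda>t. (2 * t) *\<^sub>R f - t\<^sup>2 *\<^sub>R u) ` \<rat>) (lattice_square u f)"
proof -
  obtain c where "\<bar>f\<bar> \<le> c *\<^sub>R u" using assms by (auto simp: principal_ideal_def)
  define r where "r = from_nat_into (\<rat> :: real set)"
  have r: "range r = \<rat>" unfolding r_def by (intro range_from_nat_into countable_rat) auto
  obtain s where "\<And>n. (2 * r n) *\<^sub>R f - (r n)\<^sup>2 *\<^sub>R u \<le> s"
      "\<And>b. (\<forall>n. (2 * r n) *\<^sub>R f - (r n)\<^sup>2 *\<^sub>R u \<le> b) \<Longrightarrow> s \<le> b"
    using countable_sup_exists[OF oc, of "\<lambda>n. (2 * r n) *\<^sub>R f - (r n)\<^sup>2 *\<^sub>R u"]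
      tangent_le[OF \<open>\<bar>f\<bar> \<le> c *\<^sub>R u\<close>] by blast
  then have "isLub UNIV ((\<lambda>t. (2 * t) *\<^sub>R f - t\<^sup>2 *\<^sub>R u) ` \<rat>) s"
    unfolding isLub_UNIV_iff r[symmetric] by auto
  moreover from this have "s' = s" if "isLub UNIV ((\<lambda>t. (2 * t) *\<^sub>R f - t\<^sup>2 *\<^sub>R u) ` \<rat>) s'" for s'
    using that by (auto simp: isLub_UNIV_iff intro!: antisym)
  ultimately show ?thesis unfolding lattice_square_def by (rule theI)
qed

lemma lattice_square_upper:
  "f \<in> principal_ideal u \<Longrightarrow> t \<in> \<rat> \<Longrightarrow> (2 * t) *\<^sub>R f - t\<^sup>2 *\<^sub>R u \<le> lattice_square u f"
  using isLub_lattice_square[of f] unfolding isLub_UNIV_iff by blast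

lemma lattice_square_least:
  "f \<in> principal_ideal u \<Longrightarrow> (\<And>t. t \<in> \<rat> \<Longrightarrow> (2 * t) *\<^sub>R f - t\<^sup>2 *\<^sub>R u \<le> b) \<Longrightarrow>
    lattice_square u f \<le> b"
  using isLub_lattice_square[of f] unfolding isLub_UNIV_iff by blast

lemma lattice_square_nonneg: "f \<in> principal_ideal u \<Longrightarrow> 0 \<le> lattice_square u f"
  using lattice_square_upper[of f 0] by simp

lemma lattice_square_le:
  assumes "0 \<le> c" "\<bar>f\<bar> \<le> c *\<^sub>R u"
  shows "lattice_square u f \<le> c\<^sup>2 *\<^sub>R u"
  using assms tangent_le by (intro lattice_square_least) (auto simp: principal_ideal_def)

lemma abs_le_lattice_square:
  assumes f: "f \<in> principal_ideal u" and t: "0 \<le> t" "t \<in> \<rat>"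
  shows "(2 * t) *\<^sub>R \<bar>f\<bar> \<le> lattice_square u f + t\<^sup>2 *\<^sub>R u"
proof -
  have "\<bar>(2 * t) *\<^sub>R f\<bar> \<le> lattice_square u f + t\<^sup>2 *\<^sub>R u"
    using lattice_square_upper[OF f t(2)] lattice_square_upper[OF f, of "- t"] t(2)
    by (intro abs_leI) (simp_all add: algebra_simps)
  then show ?thesis using t(1) by (simp add: scaleR_abs_lattice)
qed

text \<open>The change of slopes \<open>t = a + b\<close>, \<open>s = a - b\<close> matches the tangents of \<open>f + g\<close> and \<open>f - g\<close> with twice
those of \<open>f\<close> and \<open>g\<close>, and it is a bijection of the pairs of rational slopes.\<close>

lemma lattice_square_parallelogram:
  assumes f: "f \<in> principal_ideal u" and g: "g \<in> principal_ideal u"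
  shows "lattice_square u (f + g) + lattice_square u (f - g)
       = 2 *\<^sub>R lattice_square u f + 2 *\<^sub>R lattice_square u g"
    (is "?l = ?r")
proof -
  have fg: "f + g \<in> principal_ideal u" "f - g \<in> principal_ideal u"
    using f g subspace_principal_ideal by (auto intro: subspace_add subspace_diff)
  let ?q = "lattice_square u"
  let ?tan = "\<lambda>t x. (2 * t) *\<^sub>R x - t\<^sup>2 *\<^sub>R u"
  have quadruple: "(a * 4) *\<^sub>R x = (a * 2) *\<^sub>R x + (a * 2) *\<^sub>R x" for a and x :: 'a
    by (simp flip: scaleR_add_left)
  have change: "?tan (a + b) (f + g) + ?tan (a - b) (f - g) = 2 *\<^sub>R ?tan a f + 2 *\<^sub>R ?tan b g"
    for a b
  proof -
    have "?tan (a + b) (f + g) + ?tan (a - b) (f - g)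
        = (4 * a) *\<^sub>R f + (4 * b) *\<^sub>R g - ((a + b)\<^sup>2 + (a - b)\<^sup>2) *\<^sub>R u"
      by (simp add: algebra_simps quadruple)
    also have "(a + b)\<^sup>2 + (a - b)\<^sup>2 = 2 * a\<^sup>2 + 2 * b\<^sup>2" by (simp add: power2_sum power2_diff)
    finally show ?thesis by (simp add: algebra_simps)
  qed
  show ?thesis
  proof (rule antisym)
    have le: "?tan t (f + g) + ?tan s (f - g) \<le> ?r" if ts: "t \<in> \<rat>" "s \<in> \<rat>" for t s
    proof -
      let ?a = "(t + s) / 2" and ?b = "(t - s) / 2"
      have ab: "?a \<in> \<rat>" "?b \<in> \<rat>" using ts by auto
      have "?tan t (f + g) + ?tan s (f - g) = 2 *\<^sub>R ?tan ?a f + 2 *\<^sub>R ?tan ?b g"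
        using change[of ?a ?b] by (simp add: field_simps)
      also have "\<dots> \<le> ?r"
        by (intro add_mono scaleR_left_mono lattice_square_upper f g ab) auto
      finally show ?thesis .
    qed
    have "?q (f + g) \<le> ?r - ?tan s (f - g)" if "s \<in> \<rat>" for s
      using le that by (intro lattice_square_least fg) (simp add: algebra_simps)
    then have "?q (f - g) \<le> ?r - ?q (f + g)"
      by (intro lattice_square_least fg) (simp add: algebra_simps)
    then show "?l \<le> ?r" by (simp add: algebra_simps)
    have ge: "2 *\<^sub>R ?tan a f + 2 *\<^sub>R ?tan b g \<le> ?l" if ab: "a \<in> \<rat>" "b \<in> \<rat>" for a b
    proof -
      have "?tan (a + b) (f + g) + ?tan (a - b) (f - g) \<le> ?l"
        using ab by (intro add_mono lattice_square_upper fg) auto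
      then show ?thesis unfolding change by simp
    qed
    have half: "2 *\<^sub>R x \<le> y \<longleftrightarrow> x \<le> (1/2) *\<^sub>R y" for x y :: 'a
      using scaleR_le_cancel_left_pos[of 2 x "(1/2) *\<^sub>R y"] by simp
    have "?q f \<le> (1/2) *\<^sub>R (?l - 2 *\<^sub>R ?tan b g)" if "b \<in> \<rat>" for b
      using ge that by (intro lattice_square_least f) (simp only: half[symmetric] le_diff_eq)
    then have "2 *\<^sub>R ?q f + 2 *\<^sub>R ?tan b g \<le> ?l" if "b \<in> \<rat>" for b
      using that by (simp only: half[symmetric] le_diff_eq)
    then have "?q g \<le> (1/2) *\<^sub>R (?l - 2 *\<^sub>R ?q f)"
      by (intro lattice_square_least g) (simp only: half[symmetric] le_diff_eq add.commute)
    then show "?r \<le> ?l" by (simp only: half[symmetric] le_diff_eq add.commute)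
  qed
qed

end

section \<open>Almost orthogonal differences\<close>

text \<open>The Jordan--von Neumann argument: \<open>x \<mapsto> Q (h + x) - Q (h - x)\<close>, four times the polar form, is
additive on \<open>S\<close>.\<close>

lemma polar_form_diff:
  fixes Q :: "'b::real_vector \<Rightarrow> real"
  assumes S: "subspace S"
    and par: "\<And>x y. x \<in> S \<Longrightarrow> y \<in> S \<Longrightarrow> Q (x + y) + Q (x - y) = 2 * Q x + 2 * Q y"
    and mem: "h \<in> S" "x \<in> S" "y \<in> S"
  shows "Q (h + (x - y)) - Q (h - (x - y)) = (Q (h + x) - Q (h - x)) - (Q (h + y) - Q (h - y))"
proof -
  define B where "B z = Q (h + z) - Q (h - z)" for z
  have sum_diff: "B (f + g) + B (f - g) = 2 * B f" if "f \<in> S" "g \<in> S" for f g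
    using par[of "h + f" g] par[of "h - f" g] that mem S
    by (simp add: B_def subspace_add subspace_diff algebra_simps)
  have double: "B (f + f) = 2 * B f" if "f \<in> S" for f
    using sum_diff[OF that that] by (simp add: B_def)
  have add: "B (f + g) = B f + B g" if "f \<in> S" "g \<in> S" for f g
  proof -
    let ?p = "(1/2) *\<^sub>R (f + g)" and ?m = "(1/2) *\<^sub>R (f - g)"
    have "?p \<in> S" "?m \<in> S" using that S by (auto intro: subspace_scale subspace_add subspace_diff)
    moreover have "?p + ?m = f" "?p - ?m = g" "?p + ?p = f + g"
      by (simp_all add: scaleR_add_left[symmetric] scaleR_add_right[symmetric] scaleR_diff_right[symmetric]
          flip: scaleR_2)
    ultimately show ?thesis using sum_diff[of ?p ?m] double[of ?p] by simp
  qed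
  from add[of "x - y" y] mem S show ?thesis by (simp add: B_def subspace_diff)
qed

text \<open>A substitute for weak compactness in Hilbert space. For finitely many \<open>x\<close> the tuples of scalars
\<open>B x (f k)\<close> stay in a bounded region as \<open>k\<close> varies, so by the pigeonhole principle some difference
\<open>f a - f b\<close> with \<open>a \<noteq> b\<close> is almost orthogonal to all these \<open>x\<close>. Choosing each \<open>g n\<close> almost orthogonal to
all differences of subset sums of its predecessors, the mixed terms in the expansion of \<open>Q\<close> at a signed
sum contribute at most \<open>1\<close> per summand, whatever the signs.\<close>

lemma almost_orthogonal_differences:
  fixes Q :: "'b::real_vector \<Rightarrow> real" and f :: "nat \<Rightarrow> 'b"
  assumes S: "subspace S"
    and par: "\<And>x y. x \<in> S \<Longrightarrow> y \<in> S \<Longrightarrow> Q (x + y) + Q (x - y) = 2 * Q x + 2 * Q y"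
    and f: "\<And>k. f k \<in> S"
    and bd: "\<And>x. x \<in> S \<Longrightarrow> \<exists>M. \<forall>k. \<bar>Q (x + f k) - Q (x - f k)\<bar> \<le> M"
  obtains g :: "nat \<Rightarrow> 'b" where "\<And>n. \<exists>a b. a \<noteq> b \<and> g n = f a - f b"
    and "\<And>G A. finite G \<Longrightarrow> A \<subseteq> G \<Longrightarrow>
           Q (sum g A - sum g (G - A)) \<le> (\<Sum>i\<in>G. Q (g i) + 1)"
proof -
  define B where "B x z = Q (x + z) - Q (x - z)" for x z
  have Bdiff: "B x (f a - f b) = B x (f a) - B x (f b)" if "x \<in> S" for x a b
    unfolding B_def by (rule polar_form_diff[OF S par that f f])
  have next_ex: "\<exists>a b. a \<noteq> b \<and> (\<forall>x\<in>X. \<bar>B x (f a - f b)\<bar> \<le> 1)" if X: "finite X" "X \<subseteq> S" for X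
  proof -
    obtain M where M: "\<And>x k. x \<in> S \<Longrightarrow> \<bar>B x (f k)\<bar> \<le> M x"
      using bd unfolding B_def by metis
    \<comment> \<open>Two indices with equal integer parts for all \<open>x\<close> give the required difference.\<close>
    let ?F = "\<lambda>k. \<lambda>x\<in>X. \<lfloor>B x (f k)\<rfloor>"
    have "finite (PiE X (\<lambda>x. {\<lfloor>- M x\<rfloor>..\<lfloor>M x\<rfloor>}))" using X(1) by (intro finite_PiE) auto
    moreover have "range ?F \<subseteq> PiE X (\<lambda>x. {\<lfloor>- M x\<rfloor>..\<lfloor>M x\<rfloor>})"
    proof (intro image_subsetI PiE_I)
      fix k x assume "x \<in> X"
      then have "\<bar>B x (f k)\<bar> \<le> M x" using M X(2) by blast
      then have "- M x \<le> B x (f k)" "B x (f k) \<le> M x" by linarith+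
      with \<open>x \<in> X\<close> show "?F k x \<in> {\<lfloor>- M x\<rfloor>..\<lfloor>M x\<rfloor>}" by (simp add: floor_mono)
    qed simp
    ultimately have "\<not> inj ?F"
      using finite_subset finite_imageD infinite_UNIV_nat by blast
    then obtain a b where ab: "a \<noteq> b" "?F a = ?F b" by (auto simp: inj_def)
    have "\<bar>B x (f a - f b)\<bar> \<le> 1" if "x \<in> X" for x
    proof -
      have "\<lfloor>B x (f a)\<rfloor> = \<lfloor>B x (f b)\<rfloor>" using fun_cong[OF ab(2), of x] that by simp
      then have "\<bar>B x (f a) - B x (f b)\<bar> \<le> 1" by linarith
      then show ?thesis using Bdiff that X(2) by auto
    qed
    with ab(1) show ?thesis by blast
  qed
  define step where "step g n r \<longleftrightarrow> (\<exists>a b. a \<noteq> b \<and> r = f a - f b) \<and>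
      (\<forall>A A'. A \<subseteq> {..<n} \<longrightarrow> A' \<subseteq> {..<n} \<longrightarrow> \<bar>B (sum g A - sum g A') r\<bar> \<le> 1)"
    for g :: "nat \<Rightarrow> 'b" and n r
  have stepS: "r \<in> S" if "step g n r" for g n r
    using that f S unfolding step_def by (auto intro: subspace_diff)
  have "\<exists>g. \<forall>n. step g n (g n)"
  proof (rule dependent_wellorder_choice)
    fix r and g g' :: "nat \<Rightarrow> 'b" and n assume eq: "\<And>i. i < n \<Longrightarrow> g i = g' i"
    have "sum g A = sum g' A" if "A \<subseteq> {..<n}" for A
      using that eq by (intro sum.cong) auto
    then show "step g n r = step g' n r" by (simp add: step_def)
  next
    fix n and g :: "nat \<Rightarrow> 'b" assume prev: "\<And>i. i < n \<Longrightarrow> step g i (g i)"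
    let ?X = "(\<lambda>(A, A'). sum g A - sum g A') ` (Pow {..<n} \<times> Pow {..<n})"
    have "?X \<subseteq> S"
      using stepS[OF prev] by (auto intro!: subspace_diff subspace_sum S)
    then obtain a b where ab: "a \<noteq> b" "\<And>x. x \<in> ?X \<Longrightarrow> \<bar>B x (f a - f b)\<bar> \<le> 1"
      using next_ex[of ?X] by (metis finite_imageI finite_SigmaI finite_Pow_iff finite_lessThan)
    have "\<bar>B (sum g A - sum g A') (f a - f b)\<bar> \<le> 1" if "A \<subseteq> {..<n}" "A' \<subseteq> {..<n}" for A A'
      using that by (intro ab(2) image_eqI[of _ _ "(A, A')"]) auto
    with ab(1) show "\<exists>r. step g n r" unfolding step_def by blast
  qed
  then obtain g where g: "\<And>n. step g n (g n)" by blast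
  have gS: "g n \<in> S" for n using stepS[OF g] .
  have Q_pm: "Q (x + z) = Q x + Q z + B x z / 2" "Q (x - z) = Q x + Q z - B x z / 2"
    if "x \<in> S" "z \<in> S" for x z
    using par[OF that] by (simp_all add: B_def field_simps)
  have bound: "Q (sum g A - sum g (G - A)) \<le> (\<Sum>i\<in>G. Q (g i) + 1)" if "finite G" "A \<subseteq> G" for G A
    using that
  proof (induction G arbitrary: A rule: finite_linorder_max_induct)
    case empty
    then show ?case using par[of 0 0] S by (simp add: subspace_0)
  next
    case (insert m G)
    let ?A = "A - {m}"
    let ?x = "sum g ?A - sum g (G - ?A)"
    have fin: "finite A" using insert.hyps insert.prems by (auto intro: finite_subset)
    have x: "?x \<in> S" by (intro subspace_diff subspace_sum S gS)
    have "\<bar>B ?x (g m)\<bar> \<le> 1"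
    proof -
      have "?A \<subseteq> {..<m}" "G - ?A \<subseteq> {..<m}" using insert.hyps(2) insert.prems by auto
      with g[of m] show ?thesis unfolding step_def by blast
    qed
    then have bound: "Q (?x + g m) \<le> Q ?x + Q (g m) + 1" "Q (?x - g m) \<le> Q ?x + Q (g m) + 1"
      unfolding Q_pm[OF x gS] by linarith+
    have split: "sum g A - sum g (insert m G - A) = (if m \<in> A then ?x + g m else ?x - g m)"
    proof (cases "m \<in> A")
      case True
      then have "insert m G - A = G - ?A" using insert.hyps(2) by auto
      with True fin show ?thesis by (simp add: sum.remove[of A m])
    next
      case False
      then have "insert m G - A = insert m (G - ?A)" "m \<notin> G - ?A" using insert.hyps(2) by auto
      with False insert.hyps(1) show ?thesis by simp
    qed
    have IH: "Q ?x \<le> (\<Sum>i\<in>G. Q (g i) + 1)" using insert.prems by (intro insert.IH) auto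
    have "Q (sum g A - sum g (insert m G - A)) \<le> Q ?x + Q (g m) + 1"
      unfolding split using bound by (cases "m \<in> A") (simp_all only: if_True if_False)
    with IH have "Q (sum g A - sum g (insert m G - A)) \<le> (\<Sum>i\<in>G. Q (g i) + 1) + (Q (g m) + 1)"
      by linarith
    moreover have "m \<notin> G" using insert.hyps(2) by blast
    ultimately show ?case using insert.hyps(1) by (simp add: add.commute)
  qed
  have "\<exists>a b. a \<noteq> b \<and> g n = f a - f b" for n
    using g[of n] unfolding step_def by (rule conjunct1)
  from that[OF this bound] show thesis .
qed

section \<open>Images of order intervals\<close>

text \<open>Suppose that the images are \<open>e\<close>-separated, and take almost orthogonal differences \<open>g i\<close> of the \<open>f n\<close>
for the form \<open>Q\<close> given by a functional \<open>\<phi>\<close> that detects the norm. A signed sum \<open>s\<close> of \<open>n\<close> of them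
has \<open>Q s = O(n)\<close>, so \<open>s / n\<close> is small under \<open>\<phi>\<close> and hence in norm, as it stays in an order interval.
Domination then yields \<open>\<Sum> \<bar>T (g i)\<bar> \<le> n \<delta> u\<close> over every set of \<open>n \<ge> N\<close> indices. Intuitively, at each
point fewer than \<open>N\<close> of the \<open>\<bar>T (g i)\<bar>\<close> exceed \<open>\<delta> u\<close>. Therefore the sums of the excesses
\<open>(\<bar>T (g i)\<bar> - \<delta> u)\<^sup>+\<close> are order bounded, the excesses tend to \<open>0\<close> in norm, and
\<open>limsup \<parallel>T (g i)\<parallel> \<le> \<delta> \<parallel>u\<parallel> < e\<close> contradicts the separation.\<close>

lemma image_of_order_bounded_sequence_not_separated:
  fixes T :: "'a::banach_lattice \<Rightarrow> 'a" and f :: "nat \<Rightarrow> 'a"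
  assumes oc: "order_continuous_norm TYPE('a)" and u: "0 \<le> u" and w: "0 \<le> w"
    and T: "linear T" and dom: "\<And>x. \<bar>T x\<bar> \<le> (C * norm x) *\<^sub>R u" and C: "0 < C"
    and f: "\<And>n. \<bar>f n\<bar> \<le> w" and e: "0 < e"
  shows "\<exists>a b. a \<noteq> b \<and> norm (T (f a) - T (f b)) < e"
proof (rule ccontr)
  assume "\<not> ?thesis"
  then have sep: "e \<le> norm (T (f a) - T (f b))" if "a \<noteq> b" for a b
    using that by (meson not_le)
  define \<delta> where "\<delta> = e / (2 * (norm u + 1))"
  have nu: "0 < norm u + 1" using norm_ge_zero[of u] by linarith
  have \<delta>: "0 < \<delta>" using e nu by (simp add: \<delta>_def)
  have \<delta>u: "\<delta> * norm u < e"
  proof -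
    have "norm u < 2 * (norm u + 1)" by (simp add: distrib_left add_nonneg_pos)
    then have "\<delta> * norm u < \<delta> * (2 * (norm u + 1))" using \<delta> by (rule mult_strict_left_mono)
    also have "\<dots> = e" using nu by (simp add: \<delta>_def)
    finally show ?thesis .
  qed
  obtain \<phi> \<eta> where \<phi>: "positive_functional \<phi>" and \<eta>: "0 < \<eta>"
    and detect: "\<And>h. 0 \<le> h \<Longrightarrow> h \<le> 2 *\<^sub>R w \<Longrightarrow> \<phi> h < \<eta> \<Longrightarrow> norm h < \<delta> / C"
    using functional_detects_norm[OF oc, of "\<delta> / C" "2 *\<^sub>R w"] \<delta> C by auto
  have lin: "linear \<phi>" using \<phi> positive_functionalD(1) bounded_linear.linear by blast
  define Q where "Q x = \<phi> (lattice_square w x)" for x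
  let ?S = "principal_ideal w"
  have S: "subspace ?S" by (rule subspace_principal_ideal)
  have Q_bd: "0 \<le> Q x" "Q x \<le> c\<^sup>2 * \<phi> w" if "\<bar>x\<bar> \<le> c *\<^sub>R w" "0 \<le> c" for x c
  proof -
    have "x \<in> ?S" using that by (auto simp: principal_ideal_def)
    then show "0 \<le> Q x"
      unfolding Q_def by (intro positive_functionalD(2)[OF \<phi>] lattice_square_nonneg[OF oc w])
    show "Q x \<le> c\<^sup>2 * \<phi> w"
      using positive_functionalD(3)[OF \<phi> lattice_square_le[OF oc w that(2,1)]]
      by (simp add: Q_def linear_scale[OF lin])
  qed
  have fS: "f k \<in> ?S" for k using f[of k] by (auto simp: principal_ideal_def intro!: exI[of _ 1])
  have bd: "\<exists>M. \<forall>k. \<bar>Q (x + f k) - Q (x - f k)\<bar> \<le> M" if x: "x \<in> ?S" for x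
  proof -
    obtain c where c: "0 \<le> c" "\<bar>x\<bar> \<le> c *\<^sub>R w" using x by (auto simp: principal_ideal_def)
    have "\<bar>Q (x + f k) - Q (x - f k)\<bar> \<le> (c + 1)\<^sup>2 * \<phi> w" for k
    proof -
      have "\<bar>x\<bar> + \<bar>f k\<bar> \<le> (c + 1) *\<^sub>R w"
        using add_mono[OF c(2) f[of k]] by (simp add: scaleR_add_left)
      then have "\<bar>x + f k\<bar> \<le> (c + 1) *\<^sub>R w" "\<bar>x - f k\<bar> \<le> (c + 1) *\<^sub>R w"
        using abs_triangle_ineq abs_triangle_ineq4 order_trans by blast+
      then show ?thesis using Q_bd[of "x + f k" "c + 1"] Q_bd[of "x - f k" "c + 1"] c(1) by linarith
    qed
    then show ?thesis by blast
  qed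
  have par: "Q (x + y) + Q (x - y) = 2 * Q x + 2 * Q y" if "x \<in> ?S" "y \<in> ?S" for x y
    using arg_cong[OF lattice_square_parallelogram[OF oc w that], of \<phi>]
    by (simp add: Q_def linear_add[OF lin] linear_scale[OF lin])
  obtain g :: "nat \<Rightarrow> 'a" where g: "\<And>n. \<exists>a b. a \<noteq> b \<and> g n = f a - f b"
    and Qg: "\<And>G A. finite G \<Longrightarrow> A \<subseteq> G \<Longrightarrow> Q (sum g A - sum g (G - A)) \<le> (\<Sum>i\<in>G. Q (g i) + 1)"
    by (rule almost_orthogonal_differences[where S = ?S and Q = Q and f = f])
      ((assumption | rule S par fS bd)+, rule that)
  have g_le: "\<bar>g i\<bar> \<le> 2 *\<^sub>R w" for i
  proof -
    obtain a b where "g i = f a - f b" using g by blast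
    then have "\<bar>g i\<bar> \<le> \<bar>f a\<bar> + \<bar>f b\<bar>" by (simp add: abs_triangle_ineq4)
    also have "\<dots> \<le> 2 *\<^sub>R w" using add_mono[OF f f] by (simp add: scaleR_2)
    finally show ?thesis .
  qed
  define y where "y i = T (g i)" for i
  have y_ge: "e \<le> norm (y i)" for i
    using g[of i] sep unfolding y_def by (metis linear_diff[OF T])
  define c where "c = 4 * \<phi> w + 1"
  have \<phi>w: "0 \<le> \<phi> w" using positive_functionalD(2)[OF \<phi> w] .
  then have c: "0 < c" by (simp add: c_def)
  \<comment> \<open>The tangent at \<open>t\<close> gives \<open>\<phi> \<bar>s\<bar> / n \<le> c / (2 t) + t \<phi> w / (2 n)\<close>; \<open>t\<close> and then \<open>N\<close> are chosen
    so that each term is below \<open>\<eta> / 2\<close> for \<open>n \<ge> N\<close>.\<close>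
  obtain t :: nat where t: "c / \<eta> < real t" using reals_Archimedean2 by blast
  then have t0: "0 < real t" using c \<eta> by (meson divide_pos_pos less_trans)
  obtain N :: nat where N: "real t * \<phi> w / \<eta> < real N" using reals_Archimedean2 by blast
  have signed: "norm (sum g A - sum g (G - A)) \<le> real (card G) * (\<delta> / C)"
    if G: "finite G" "A \<subseteq> G" "N \<le> card G" for G A
  proof -
    define s where "s = sum g A - sum g (G - A)"
    define n where "n = real (card G)"
    have "0 < real N" using N \<phi>w t0 \<eta> by (meson divide_nonneg_pos le_less_trans less_imp_le mult_nonneg_nonneg)
    then have n0: "0 < n" and nN: "real N \<le> n" using G(3) by (auto simp: n_def)
    have "finite A" using G finite_subset by blast
    have "\<bar>s\<bar> \<le> (\<Sum>i\<in>A. \<bar>g i\<bar>) + (\<Sum>i\<in>G - A. \<bar>g i\<bar>)"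
      unfolding s_def by (rule order_trans[OF abs_triangle_ineq4 add_mono]) (rule sum_abs)+
    also have "\<dots> = (\<Sum>i\<in>G. \<bar>g i\<bar>)" using G by (simp add: sum.subset_diff add.commute)
    also have "\<dots> \<le> (\<Sum>i\<in>G. 2 *\<^sub>R w)" by (intro sum_mono g_le)
    also have "\<dots> = n *\<^sub>R 2 *\<^sub>R w" by (simp add: n_def sum_constant_scaleR)
    finally have s_le: "\<bar>s\<bar> \<le> n *\<^sub>R 2 *\<^sub>R w" .
    then have sS: "s \<in> ?S" using n0 by (auto simp: principal_ideal_def intro!: exI[of _ "n * 2"])
    have "Q s \<le> (\<Sum>i\<in>G. Q (g i) + 1)" unfolding s_def using G by (intro Qg)
    also have "\<dots> \<le> (\<Sum>i\<in>G. c)"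
      using Q_bd(2)[OF g_le] by (intro sum_mono) (simp add: c_def)
    also have "\<dots> = n * c" by (simp add: n_def)
    finally have Qs: "Q s \<le> n * c" .
    have "2 * real t * \<phi> \<bar>s\<bar> \<le> Q s + (real t)\<^sup>2 * \<phi> w"
      using positive_functionalD(3)[OF \<phi> abs_le_lattice_square[OF oc w sS, of "real t"]] t0
      by (simp add: Q_def linear_add[OF lin] linear_scale[OF lin])
    also have "\<dots> \<le> n * c + real t * (real t * \<phi> w)"
      using Qs by (simp add: power2_eq_square mult.assoc)
    also have "\<dots> < n * (real t * \<eta>) + real t * (n * \<eta>)"
    proof (rule add_strict_mono)
      show "n * c < n * (real t * \<eta>)" using t \<eta> n0 by (simp add: field_simps)
      have "real t * \<phi> w < real N * \<eta>" using N \<eta> by (simp add: field_simps)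
      also have "\<dots> \<le> n * \<eta>" using nN \<eta> by simp
      finally show "real t * (real t * \<phi> w) < real t * (n * \<eta>)" using t0 by simp
    qed
    finally have "2 * real t * \<phi> \<bar>s\<bar> < 2 * real t * (n * \<eta>)" by (simp add: algebra_simps)
    then have "\<phi> \<bar>s\<bar> < n * \<eta>" using t0 by simp
    then have "\<phi> (inverse n *\<^sub>R \<bar>s\<bar>) < \<eta>" using n0 by (simp add: linear_scale[OF lin] field_simps)
    moreover have "inverse n *\<^sub>R \<bar>s\<bar> \<le> 2 *\<^sub>R w"
      using scaleR_left_mono[OF s_le, of "inverse n"] n0 by (simp add: field_simps)
    ultimately have "norm (inverse n *\<^sub>R \<bar>s\<bar>) < \<delta> / C"
      using n0 by (intro detect scaleR_nonneg_nonneg) auto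
    then show ?thesis using n0 by (simp add: norm_abs_lattice s_def n_def field_simps)
  qed
  have large: "(\<Sum>i\<in>G. \<bar>y i\<bar>) \<le> (real (card G) * \<delta>) *\<^sub>R u" if "finite G" "N \<le> card G" for G
  proof (rule sum_abs_le_if_signed_sums_le[OF \<open>finite G\<close>])
    fix A assume "A \<subseteq> G"
    have "sum y A - sum y (G - A) = T (sum g A - sum g (G - A))"
      by (simp add: y_def linear_diff[OF T] linear_sum[OF T])
    also have "\<dots> \<le> (C * norm (sum g A - sum g (G - A))) *\<^sub>R u"
      using dom abs_ge_self order_trans by blast
    also have "\<dots> \<le> (C * (real (card G) * (\<delta> / C))) *\<^sub>R u"
      using signed[OF that(1) \<open>A \<subseteq> G\<close> that(2)] C by (intro scaleR_right_mono u mult_left_mono) auto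
    finally show "sum y A - sum y (G - A) \<le> (real (card G) * \<delta>) *\<^sub>R u" using C by simp
  qed
  \<comment> \<open>Sums over at least \<open>N\<close> indices are nonpositive, shorter ones are bounded termwise.\<close>
  define z where "z = (real N * (C * (2 * norm w))) *\<^sub>R u"
  have z: "0 \<le> z" unfolding z_def using C u by (intro scaleR_nonneg_nonneg) auto
  have partial: "(\<Sum>i\<in>A. \<bar>y i\<bar> - \<delta> *\<^sub>R u) \<le> z" if A: "finite A" for A
  proof (cases "N \<le> card A")
    case True
    have "(\<Sum>i\<in>A. \<bar>y i\<bar> - \<delta> *\<^sub>R u) = (\<Sum>i\<in>A. \<bar>y i\<bar>) - (real (card A) * \<delta>) *\<^sub>R u"
      by (simp add: sum_subtractf sum_constant_scaleR)
    also have "\<dots> \<le> 0" using large[OF A True] by simp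
    finally show ?thesis using z by simp
  next
    case False
    have "(\<Sum>i\<in>A. \<bar>y i\<bar> - \<delta> *\<^sub>R u) \<le> (\<Sum>i\<in>A. (C * (2 * norm w)) *\<^sub>R u)"
    proof (rule sum_mono)
      fix i
      have "norm (g i) \<le> 2 * norm w"
        using norm_mono_nonneg[OF abs_ge_zero g_le[of i]] by (simp add: norm_abs_lattice)
      then have "(C * norm (g i)) *\<^sub>R u \<le> (C * (2 * norm w)) *\<^sub>R u"
        using C by (intro scaleR_right_mono u mult_left_mono) auto
      with dom[of "g i"] have "\<bar>y i\<bar> \<le> (C * (2 * norm w)) *\<^sub>R u" by (simp add: y_def)
      moreover have "0 \<le> \<delta> *\<^sub>R u" using \<delta> u by (simp add: scaleR_nonneg_nonneg)
      ultimately show "\<bar>y i\<bar> - \<delta> *\<^sub>R u \<le> (C * (2 * norm w)) *\<^sub>R u"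
        by (simp add: diff_le_eq add_increasing2)
    qed
    also have "\<dots> = (real (card A) * (C * (2 * norm w))) *\<^sub>R u" by (simp add: sum_constant_scaleR)
    also have "\<dots> \<le> z"
      unfolding z_def using False C by (intro scaleR_right_mono u mult_right_mono) auto
    finally show ?thesis .
  qed
  have lim: "(\<lambda>i. sup (\<bar>y i\<bar> - \<delta> *\<^sub>R u) 0) \<longlonglongrightarrow> 0"
  proof (rule order_bounded_sums_imp_terms_tendsto_zero[OF oc])
    show "(\<Sum>i<n. sup (\<bar>y i\<bar> - \<delta> *\<^sub>R u) 0) \<le> z" for n
      by (intro sum_pos_part_le_if_partial_sums_le partial) (auto intro: finite_subset)
  qed simp
  have "e - \<delta> * norm u \<le> norm (sup (\<bar>y i\<bar> - \<delta> *\<^sub>R u) 0)" for i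
  proof -
    have "\<bar>y i\<bar> - \<delta> *\<^sub>R u \<le> sup (\<bar>y i\<bar> - \<delta> *\<^sub>R u) 0" by simp
    then have "\<bar>y i\<bar> \<le> sup (\<bar>y i\<bar> - \<delta> *\<^sub>R u) 0 + \<delta> *\<^sub>R u" by (simp only: diff_le_eq)
    then have "norm \<bar>y i\<bar> \<le> norm (sup (\<bar>y i\<bar> - \<delta> *\<^sub>R u) 0 + \<delta> *\<^sub>R u)" by (intro norm_mono_nonneg) simp_all
    also have "\<dots> \<le> norm (sup (\<bar>y i\<bar> - \<delta> *\<^sub>R u) 0) + \<delta> * norm u"
      using norm_triangle_ineq[of "sup (\<bar>y i\<bar> - \<delta> *\<^sub>R u) 0" "\<delta> *\<^sub>R u"] \<delta> by simp
    finally show ?thesis using y_ge[of i] by (simp add: norm_abs_lattice)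
  qed
  moreover obtain i where "norm (sup (\<bar>y i\<bar> - \<delta> *\<^sub>R u) 0) < e - \<delta> * norm u"
    using LIMSEQ_D[OF lim, of "e - \<delta> * norm u"] \<delta>u by auto
  ultimately show False by (meson not_le)
qed

lemma compact_closure_image_order_interval:
  fixes T :: "'a::banach_lattice \<Rightarrow> 'a"
  assumes oc: "order_continuous_norm TYPE('a)" and u: "0 \<le> u" and w: "0 \<le> w"
    and T: "bounded_linear T" and range: "range T \<subseteq> principal_ideal u"
  shows "compact (closure (T ` {f. \<bar>f\<bar> \<le> w}))"
  unfolding compact_eq_totally_bounded
proof (intro conjI allI impI)
  obtain C where C: "0 < C" and dom: "\<And>x. \<bar>T x\<bar> \<le> (C * norm x) *\<^sub>R u"
    using operator_into_principal_ideal_dominated[OF T range u] by blast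
  show "complete (closure (T ` {f. \<bar>f\<bar> \<le> w}))" by (simp add: complete_eq_closed)
  fix e :: real assume e: "0 < e"
  show "\<exists>k. finite k \<and> closure (T ` {f. \<bar>f\<bar> \<le> w}) \<subseteq> (\<Union>x\<in>k. ball x e)"
  proof (rule ccontr)
    assume neg: "\<not> ?thesis"
    define step where "step f n r \<longleftrightarrow> \<bar>r\<bar> \<le> w \<and> (\<forall>i<n. e / 2 \<le> norm (T (f i) - T r))"
      for f :: "nat \<Rightarrow> 'a" and n r
    have "\<exists>f. \<forall>n. step f n (f n)"
    proof (rule dependent_wellorder_choice)
      fix n :: nat and f :: "nat \<Rightarrow> 'a"
      show "\<exists>r. step f n r"
      proof (rule ccontr)
        assume "\<not> ?thesis"
        then have near: "\<exists>i<n. norm (T (f i) - T r) < e / 2" if "\<bar>r\<bar> \<le> w" for r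
          using that by (auto simp: step_def not_le)
        have "T ` {f. \<bar>f\<bar> \<le> w} \<subseteq> (\<Union>i<n. cball (T (f i)) (e / 2))"
        proof (rule image_subsetI)
          fix r assume "r \<in> {f. \<bar>f\<bar> \<le> w}"
          then obtain i where "i < n" "norm (T (f i) - T r) < e / 2" using near by auto
          then show "T r \<in> (\<Union>i<n. cball (T (f i)) (e / 2))"
            by (intro UN_I[of i]) (auto simp: dist_norm)
        qed
        then have "closure (T ` {f. \<bar>f\<bar> \<le> w}) \<subseteq> (\<Union>i<n. cball (T (f i)) (e / 2))"
          by (intro closure_minimal closed_UN) auto
        also have "\<dots> \<subseteq> (\<Union>x\<in>(\<lambda>i. T (f i)) ` {..<n}. ball x e)" using e by auto
        finally show False using neg by blast
      qed
    qed (simp add: step_def)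
    then obtain f where "\<And>n. step f n (f n)" by blast
    then have f: "\<bar>f n\<bar> \<le> w" "i < n \<Longrightarrow> e / 2 \<le> norm (T (f i) - T (f n))" for i n
      by (simp_all add: step_def)
    obtain a b where ab: "a \<noteq> b" "norm (T (f a) - T (f b)) < e / 2"
      using image_of_order_bounded_sequence_not_separated[where f = f and e = "e / 2", OF oc u w
          bounded_linear.linear[OF T] dom C f(1)] e by auto
    then show False
      using f(2)[of a b] f(2)[of b a] by (cases a b rule: linorder_cases) (auto simp: norm_minus_commute)
  qed
qed

section \<open>Compactness of the composition\<close>

lemma compact_closure_if_subset_compact:
  fixes A :: "'b::metric_space set"
  assumes "A \<subseteq> K" "compact K"
  shows "compact (closure A)"
proof -
  have "closure A \<subseteq> K" using assms by (intro closure_minimal compact_imp_closed)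
  then have "K \<inter> closure A = closure A" by blast
  then show ?thesis using compact_Int_closed[OF assms(2), of "closure A"] by simp
qed

lemma bounded_linear_complexification_parts:
  "bounded_linear (real_part :: 'a::banach_lattice complexification \<Rightarrow> 'a)"
  "bounded_linear (imag_part :: 'a::banach_lattice complexification \<Rightarrow> 'a)"
  "bounded_linear (\<lambda>x :: 'a::banach_lattice. Complexification x 0)"
  "bounded_linear (\<lambda>x :: 'a::banach_lattice. Complexification 0 x)"
proof -
  show "bounded_linear (real_part :: 'a complexification \<Rightarrow> 'a)"
    by (rule bounded_linear_intro[of _ 1]) (simp_all add: norm_real_part_le)
  show "bounded_linear (imag_part :: 'a complexification \<Rightarrow> 'a)"
    by (rule bounded_linear_intro[of _ 1]) (simp_all add: norm_imag_part_le)
  show "bounded_linear (\<lambda>x :: 'a. Complexification x 0)"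
    using norm_complexification_le[of "Complexification _ 0"]
    by (intro bounded_linear_intro[of _ 1]) (auto intro: complexification.expand)
  show "bounded_linear (\<lambda>x :: 'a. Complexification 0 x)"
    using norm_complexification_le[of "Complexification 0 _"]
    by (intro bounded_linear_intro[of _ 1]) (auto intro: complexification.expand)
qed

lemma parts_in_principal_ideal:
  assumes "z \<in> complex_principal_ideal u"
  shows "real_part z \<in> principal_ideal u" "imag_part z \<in> principal_ideal u"
  using assms order_trans[OF abs_real_part_le_modulus] order_trans[OF abs_imag_part_le_modulus]
  unfolding complex_principal_ideal_def principal_ideal_def by blast+

lemma compact_operator_comp_real:
  fixes T1 T2 :: "'a::banach_lattice \<Rightarrow> 'a"
  assumes oc: "order_continuous_norm TYPE('a)" and u: "0 \<le> u"
    and T1: "bounded_linear T1" "range T1 \<subseteq> principal_ideal u"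
    and T2: "bounded_linear T2" "range T2 \<subseteq> principal_ideal u"
  shows "compact_operator (T2 \<circ> T1)"
proof -
  obtain C where C: "0 \<le> C" "\<And>x. x \<in> cball 0 1 \<Longrightarrow> \<bar>T1 x\<bar> \<le> C *\<^sub>R u"
    using unit_ball_image_in_order_interval[OF T1 u] by blast
  have "(T2 \<circ> T1) ` cball 0 1 \<subseteq> T2 ` {f. \<bar>f\<bar> \<le> C *\<^sub>R u}" using C(2) by auto
  also have "\<dots> \<subseteq> closure (T2 ` {f. \<bar>f\<bar> \<le> C *\<^sub>R u})" by (rule closure_subset)
  finally show ?thesis
    unfolding compact_operator_def
    by (rule compact_closure_if_subset_compact)
      (intro compact_closure_image_order_interval[OF oc u _ T2] scaleR_nonneg_nonneg C(1) u)
qed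

text \<open>As a real operator, \<open>T2\<close> is a two-by-two matrix of operators on the real Banach lattice, each with
range in the ideal of \<open>u\<close>. The real and imaginary parts of \<open>T1\<close> map the unit ball into order
intervals, whose images under the four entries are relatively compact.\<close>

lemma compact_operator_comp_complex:
  fixes T1 T2 :: "'a::banach_lattice complexification \<Rightarrow> 'a complexification"
  assumes oc: "order_continuous_norm TYPE('a)" and u: "0 \<le> u"
    and T1: "bounded_linear T1" "range T1 \<subseteq> complex_principal_ideal u"
    and T2: "bounded_linear T2" "range T2 \<subseteq> complex_principal_ideal u"
  shows "compact_operator (T2 \<circ> T1)"
proof -
  note parts = bounded_linear_complexification_parts
  define R where "R z = real_part (T1 z)" for z
  define I where "I z = imag_part (T1 z)" for z
  have "bounded_linear R" "bounded_linear I"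
    unfolding R_def I_def
    by (rule bounded_linear_compose[OF parts(1) T1(1)] bounded_linear_compose[OF parts(2) T1(1)])+
  moreover have "range R \<subseteq> principal_ideal u" "range I \<subseteq> principal_ideal u"
    using T1(2) parts_in_principal_ideal unfolding R_def I_def by blast+
  ultimately obtain C D where C: "0 \<le> C" "\<And>z. z \<in> cball 0 1 \<Longrightarrow> \<bar>R z\<bar> \<le> C *\<^sub>R u"
    and D: "0 \<le> D" "\<And>z. z \<in> cball 0 1 \<Longrightarrow> \<bar>I z\<bar> \<le> D *\<^sub>R u"
    using unit_ball_image_in_order_interval u by metis
  define A11 where "A11 x = real_part (T2 (Complexification x 0))" for x
  define A12 where "A12 x = real_part (T2 (Complexification 0 x))" for x
  define A21 where "A21 x = imag_part (T2 (Complexification x 0))" for x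
  define A22 where "A22 x = imag_part (T2 (Complexification 0 x))" for x
  have lin: "bounded_linear A11" "bounded_linear A12" "bounded_linear A21" "bounded_linear A22"
    unfolding A11_def A12_def A21_def A22_def
    by (intro bounded_linear_compose[OF parts(1)] bounded_linear_compose[OF parts(2)]
        bounded_linear_compose[OF T2(1)] parts)+
  have rng: "range A11 \<subseteq> principal_ideal u" "range A12 \<subseteq> principal_ideal u"
    "range A21 \<subseteq> principal_ideal u" "range A22 \<subseteq> principal_ideal u"
    using T2(2) parts_in_principal_ideal unfolding A11_def A12_def A21_def A22_def by blast+
  define K where "K A c = closure (A ` {f. \<bar>f\<bar> \<le> c *\<^sub>R u})" for A :: "'a \<Rightarrow> 'a" and c
  have K: "compact (K A c)" if "bounded_linear A" "range A \<subseteq> principal_ideal u" "0 \<le> c" for A c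
    unfolding K_def using that u
    by (intro compact_closure_image_order_interval[OF oc u]) (auto intro: scaleR_nonneg_nonneg)
  have KI: "A f \<in> K A c" if "\<bar>f\<bar> \<le> c *\<^sub>R u" for A f c
    unfolding K_def using that by (intro subsetD[OF closure_subset] imageI) simp
  let ?P = "\<lambda>((a, b), (c, d)). Complexification (a + b) 0 + Complexification 0 (c + d)"
  let ?K = "?P ` ((K A11 C \<times> K A12 D) \<times> (K A21 C \<times> K A22 D))"
  have "compact ?K"
  proof (rule compact_continuous_image)
    show "continuous_on ((K A11 C \<times> K A12 D) \<times> (K A21 C \<times> K A22 D)) ?P"
      unfolding case_prod_beta
      by (intro continuous_on_add bounded_linear.continuous_on[OF parts(3)]
          bounded_linear.continuous_on[OF parts(4)] continuous_on_fst continuous_on_snd continuous_on_id)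
    show "compact ((K A11 C \<times> K A12 D) \<times> (K A21 C \<times> K A22 D))"
      using C(1) D(1) lin rng by (intro compact_Times K)
  qed
  moreover have "(T2 \<circ> T1) ` cball 0 1 \<subseteq> ?K"
  proof (rule image_subsetI)
    fix z :: "'a complexification" assume z: "z \<in> cball 0 1"
    have "T1 z = Complexification (R z) 0 + Complexification 0 (I z)"
      by (intro complexification.expand) (simp add: R_def I_def)
    then have "T2 (T1 z) = T2 (Complexification (R z) 0) + T2 (Complexification 0 (I z))"
      using linear_add[OF bounded_linear.linear[OF T2(1)]] by simp
    also have "\<dots> = ?P ((A11 (R z), A12 (I z)), (A21 (R z), A22 (I z)))"
      by (intro complexification.expand) (simp add: A11_def A12_def A21_def A22_def)
    finally show "(T2 \<circ> T1) z \<in> ?K"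
      using KI[OF C(2)[OF z]] KI[OF D(2)[OF z]] by (simp only: o_apply) (intro imageI SigmaI; simp)
  qed
  ultimately show ?thesis
    unfolding compact_operator_def by (intro compact_closure_if_subset_compact)
qed

theorem theorem2p2:
  fixes u :: "'a::banach_lattice"
  assumes "order_continuous_norm TYPE('a)"
    and "0 \<le> u"
  shows "(\<forall>(T1 :: 'a \<Rightarrow> 'a) (T2 :: 'a \<Rightarrow> 'a).
            bounded_linear T1 \<longrightarrow> bounded_linear T2 \<longrightarrow>
            range T1 \<subseteq> principal_ideal u \<longrightarrow> range T2 \<subseteq> principal_ideal u \<longrightarrow>
            bounded_linear (T2 \<circ> T1) \<and> compact_operator (T2 \<circ> T1)) \<and>
         (\<forall>(T1 :: 'a complexification \<Rightarrow> 'a complexification)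
          (T2 :: 'a complexification \<Rightarrow> 'a complexification).
            bounded_clinear T1 \<longrightarrow> bounded_clinear T2 \<longrightarrow>
            range T1 \<subseteq> complex_principal_ideal u \<longrightarrow> range T2 \<subseteq> complex_principal_ideal u \<longrightarrow>
            bounded_clinear (T2 \<circ> T1) \<and> compact_operator (T2 \<circ> T1))"
proof (intro conjI allI impI)
  fix T1 T2 :: "'a \<Rightarrow> 'a"
  assume T: "bounded_linear T1" "bounded_linear T2"
    "range T1 \<subseteq> principal_ideal u" "range T2 \<subseteq> principal_ideal u"
  show "bounded_linear (T2 \<circ> T1)" using bounded_linear_compose[OF T(2,1)] by (simp add: o_def)
  show "compact_operator (T2 \<circ> T1)" by (rule compact_operator_comp_real[OF assms T(1,3,2,4)])
next
  fix T1 T2 :: "'a complexification \<Rightarrow> 'a complexification"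
  assume T: "bounded_clinear T1" "bounded_clinear T2"
    "range T1 \<subseteq> complex_principal_ideal u" "range T2 \<subseteq> complex_principal_ideal u"
  then have bl: "bounded_linear T1" "bounded_linear T2" by (auto simp: bounded_clinear_def)
  from bounded_linear_compose[OF bl(2,1)] T(1,2) show "bounded_clinear (T2 \<circ> T1)"
    by (simp add: bounded_clinear_def o_def)
  show "compact_operator (T2 \<circ> T1)" by (rule compact_operator_comp_complex[OF assms bl(1) T(3) bl(2) T(4)])
qed

end
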